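(* Consider a canonical one-dimensional exponential family $(\nu_\theta)_{\theta\in\Theta}$ with mean set $I$, variance bounded by $V>0$, and a fixed interval $[\mu^-,\mu^+]\subset I$, as described in the context, and let $\mathcal{F}$ be the associated set of $K$-armed bandit models, $K\ge2$. Let $\nu\in\mathcal{F}$ be a bandit model and let $a$ be a suboptimal arm, i.e. $\mu_a<\mu^\star$. For each horizon $T$, run the kl-UCB$^{++}$ algorithm with horizon $T$ on $\nu$. Then, for any $\delta$ such that $\sqrt{22VK/T}\le\delta\le(\mu^\star-\mu_a)/3$, $$\mathbb{E}[N_a(T)]\le\frac{\log(T)}{\mathrm{kl}(\mu_a+\delta,\mu^\star-\delta)}+O\left(\frac{\log\log(T)}{\delta^2}\right),$$ meaning: there exist constants $C>0$ and $T_0\ge3$, not depending on $T$ or $\delta$ (but possibly on the bandit model, $K$, $V$, $\mu^-$, $\mu^+$), such that for all $T\ge T_0$ and all $\delta$ with $\sqrt{22VK/T}\le\delta\le(\mu^\star-\mu_a)/3$, $$\mathbb{E}[N_a(T)]\le\frac{\log(T)}{\mathrm{kl}(\mu_a+\delta,\mu^\star-\delta)}+C\,\frac{\log\log(T)}{\delta^2}.$$ Consequently the algorithm is asymptotically optimal: for every $\nu\in\mathcal{F}$, $$R_T\le\Big(\sum_{a:\,\mu_a<\mu^\star}\frac{\mu^\star-\mu_a}{\mathrm{kl}(\mu_a,\mu^\star)}\Big)\log(T)+o(\log T)\qquad\text{as }T\to\infty .$$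
   Context: **Exponential family.** Let $\rho$ be a measure on $\mathbb{R}$, $b(\theta)=\log\int_{\mathbb{R}}e^{x\theta}\,d\rho(x)$ and $\Theta=\{\theta\in\mathbb{R}: b(\theta)<+\infty\}$. For $\theta\in\Theta$, $\nu_\theta$ is the probability law with density $\frac{d\nu_\theta}{d\rho}(x)=\exp(x\theta-b(\theta))$. The function $b$ is convex and twice differentiable on $\Theta$, and $b'(\theta)$ and $b''(\theta)>0$ are the mean and the variance of $\nu_\theta$. The family is parametrized by its mean $\mu=b'(\theta)$, which ranges over $I=b'(\Theta)=(\bar\mu^-,\bar\mu^+)$, an open interval. For $\mu=b'(\theta)$ and $\mu'=b'(\theta')$ in $I$, put $$\mathrm{kl}(\mu,\mu')=\mathrm{KL}(\nu_\theta,\nu_{\theta'})=b(\theta')-b(\theta)-b'(\theta)(\theta'-\theta).$$ For $\mu'\in I$, $\mathrm{kl}(\cdot,\mu')$ is extended by limits, with values in $[0,+\infty]$, to the finite endpoints of $I$ (needed when an empirical mean equals an endpoint of $I$; e.g. $0\log 0=0$ in the Bernoulli case). **Standing assumptions.** The variance is bounded over the family: $\sup_{\mu\in I} b''\big((b')^{-1}(\mu)\big)\le V<+\infty$. Consequently $\mathrm{kl}(\mu,\mu')\ge (\mu-\mu')^2/(2V)$ for all $\mu,\mu'\in I$. Two real numbers $\mu^-<\mu^+$ with $[\mu^-,\mu^+]\subset I$ are fixed. $\mathcal{F}$ is the set of bandit models $\nu=(\nu_{\theta_1},\dots,\nu_{\theta_K})$, $K\ge2$, whose arms belong to the family and have means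 $\mu_a=b'(\theta_a)\in[\mu^-,\mu^+]$. **Bandit game and regret.** At each round $1\le t\le T$ the player pulls an arm $A_t\in\{1,\dots,K\}$, chosen on the basis of past observations, and receives an independent draw $Y_t$ from $\nu_{\theta_{A_t}}$. Let $\mu^\star=\max_a\mu_a$ and $N_a(t)=\sum_{s=1}^t\mathbb{1}_{\{A_s=a\}}$. The expected regret is $$R_T=T\mu^\star-\mathbb{E}\Big[\sum_{t=1}^TY_t\Big]=\sum_{a=1}^K(\mu^\star-\mu_a)\,\mathbb{E}[N_a(T)].$$ **The kl-UCB$^{++}$ algorithm (with horizon $T$).** Let $\log_+(x)=\max(\log x,0)$ and $$g(n)=\log_+\!\Big(\frac{T}{Kn}\Big(\log_+^2\Big(\frac{T}{Kn}\Big)+1\Big)\Big).$$ During the first $K$ rounds each arm is pulled once (if $T<K$ the procedure simply stops after $T$ rounds). Then for $t=K,\dots,T-1$: with $\widehat\mu_a(t)=\frac1{N_a(t)}\sum_{s=1}^tY_s\mathbb{1}_{\{A_s=a\}}$, compute for every arm $a$ $$U_a(t)=\sup\Big\{\mu\in I:\ \mathrm{kl}\big(\widehat\mu_a(t),\mu\big)\le\frac{g(N_a(t))}{N_a(t)}\Big\}$$ (with the convention $U_a(t)=\widehat\mu_a(t)$ if this set is empty), and play $A_{t+1}\in\arg\max_{a}U_a(t)$, ties being broken arbitrarily. *)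

theory Defs
  imports "HOL-Probability.Probability" "HOL-Library.Landau_Symbols"
begin

section \<open>One-dimensional canonical exponential families\<close>

definition natural_params :: "real measure \<Rightarrow> real set" where
  "natural_params \<rho> = {\<theta>. (\<integral>\<^sup>+x. ennreal (exp (x * \<theta>)) \<partial>\<rho>) < \<infinity>}"

definition log_partition :: "real measure \<Rightarrow> real \<Rightarrow> real" where
  "log_partition \<rho> \<theta> = ln (\<integral>x. exp (x * \<theta>) \<partial>\<rho>)"

definition exp_law :: "real measure \<Rightarrow> real \<Rightarrow> real measure" where
  "exp_law \<rho> \<theta> = density \<rho> (\<lambda>x. ennreal (exp (x * \<theta> - log_partition \<rho> \<theta>)))"

abbreviation mean_fun :: "real measure \<Rightarrow> real \<Rightarrow> real" where
  "mean_fun \<rho> \<equiv> deriv (log_partition \<rho>)"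

abbreviation var_fun :: "real measure \<Rightarrow> real \<Rightarrow> real" where
  "var_fun \<rho> \<equiv> deriv (deriv (log_partition \<rho>))"

text \<open>
  Openness of the parameter set is what makes differentiability on all of it, and openness of
  the mean set, meaningful. On an open parameter set \<^const>\<open>log_partition\<close> is automatically
  smooth, so the derivatives below are genuine; the positive variance excludes point masses.
\<close>

definition canonical_exp_family :: "real measure \<Rightarrow> bool" where
  "canonical_exp_family \<rho> \<longleftrightarrow>
     sets \<rho> = sets borel \<and> natural_params \<rho> \<noteq> {} \<and> open (natural_params \<rho>) \<and>
     (\<forall>\<theta>\<in>natural_params \<rho>. 0 < var_fun \<rho> \<theta>)"

definition mean_set :: "real measure \<Rightarrow> real set" where
  "mean_set \<rho> = mean_fun \<rho> ` natural_params \<rho>"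

definition param_of_mean :: "real measure \<Rightarrow> real \<Rightarrow> real" where
  "param_of_mean \<rho> = inv_into (natural_params \<rho>) (mean_fun \<rho>)"

definition kl :: "real measure \<Rightarrow> real \<Rightarrow> real \<Rightarrow> real" where
  "kl \<rho> \<mu> \<mu>' =
     (let \<theta> = param_of_mean \<rho> \<mu>; \<theta>' = param_of_mean \<rho> \<mu>'
      in log_partition \<rho> \<theta>' - log_partition \<rho> \<theta> - mean_fun \<rho> \<theta> * (\<theta>' - \<theta>))"

text \<open>
  The derivative of \<^const>\<open>log_partition\<close> is the mean of \<^const>\<open>exp_law\<close>, and \<^const>\<open>kl\<close> is the
  Kullback-Leibler divergence: the library's \<^term>\<open>KL_divergence (exp 1) N M\<close> is the divergence
  of \<^term>\<open>M\<close> from \<^term>\<open>N\<close> in nats (lemmas \<open>mean_exp_law\<close> and \<open>kl_eq_KL_divergence\<close>).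
\<close>

lemma integrable_exp_natural_params:
  assumes "sets \<rho> = sets borel" "\<theta> \<in> natural_params \<rho>"
  shows "integrable \<rho> (\<lambda>x::real. exp (x * \<theta>))"
proof -
  have [measurable_cong]: "sets \<rho> = sets borel" by fact
  show ?thesis
    using assms(2) by (intro integrableI_nonneg) (auto simp: natural_params_def)
qed

lemma exp_remainder_bound:
  fixes e h x :: real
  assumes "0 < e" "\<bar>h\<bar> \<le> e"
  shows "\<bar>exp (h * x) - 1 - h * x\<bar> \<le> (h / e)\<^sup>2 * (exp (2 * e * x) + exp (- (2 * e * x)))"
proof -
  obtain t where t: "\<bar>t\<bar> \<le> \<bar>h * x\<bar>" "exp (h * x) = (\<Sum>m<2. (h * x) ^ m / fact m) + exp t / fact 2 * (h * x)\<^sup>2"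
    using Maclaurin_exp_le by blast
  have hx: "\<bar>h * x\<bar> \<le> e * \<bar>x\<bar>"
    using assms by (simp add: abs_mult mult_right_mono)
  have "exp (h * x) - 1 - h * x = exp t / 2 * (h * x)\<^sup>2"
    unfolding t(2) by (simp add: numeral_2_eq_2)
  moreover have "0 \<le> exp t / 2 * (h * x)\<^sup>2" by simp
  ultimately have "\<bar>exp (h * x) - 1 - h * x\<bar> = exp t / 2 * (h * x)\<^sup>2" by linarith
  also have "\<dots> = (h / e)\<^sup>2 * (exp t * ((e * x)\<^sup>2 / 2))"
    using assms by (simp add: field_simps power2_eq_square)
  also have "\<dots> \<le> (h / e)\<^sup>2 * (exp (e * \<bar>x\<bar>) * exp (e * \<bar>x\<bar>))"
  proof -
    have "exp t \<le> exp (e * \<bar>x\<bar>)" using t(1) hx by simp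
    moreover have "(e * x)\<^sup>2 / 2 \<le> exp (e * \<bar>x\<bar>)"
    proof -
      have "0 \<le> e * \<bar>x\<bar>" using assms by simp
      moreover from this have "1 + e * \<bar>x\<bar> + (e * \<bar>x\<bar>)\<^sup>2 / 2 \<le> exp (e * \<bar>x\<bar>)"
        by (rule exp_lower_Taylor_quadratic)
      moreover have "(e * \<bar>x\<bar>)\<^sup>2 = (e * x)\<^sup>2" by (simp add: power_mult_distrib)
      ultimately show ?thesis by linarith
    qed
    ultimately show ?thesis by (intro mult_left_mono mult_mono) auto
  qed
  also have "exp (e * \<bar>x\<bar>) * exp (e * \<bar>x\<bar>) = exp (2 * e * \<bar>x\<bar>)"
    by (simp add: exp_add[symmetric])
  also have "(h / e)\<^sup>2 * \<dots> \<le> (h / e)\<^sup>2 * (exp (2 * e * x) + exp (- (2 * e * x)))"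
    by (intro mult_left_mono, cases "0 \<le> x") simp_all
  finally show ?thesis .
qed

lemma
  fixes \<rho> :: "real measure"
  assumes sets: "sets \<rho> = sets borel" and op: "open (natural_params \<rho>)"
    and th: "\<theta> \<in> natural_params \<rho>"
  shows integrable_x_exp: "integrable \<rho> (\<lambda>x. x * exp (x * \<theta>))"
    and has_derivative_laplace:
      "((\<lambda>t. \<integral>x. exp (x * t) \<partial>\<rho>) has_real_derivative (\<integral>x. x * exp (x * \<theta>) \<partial>\<rho>)) (at \<theta>)"
proof -
  have [measurable_cong]: "sets \<rho> = sets borel" by fact
  obtain r where r: "r > 0" "cball \<theta> r \<subseteq> natural_params \<rho>"
    using op th open_contains_cball by blast
  define e where "e = r / 2"
  have e: "e > 0" using r by (simp add: e_def)
  have np: "\<theta> + h \<in> natural_params \<rho>" if "\<bar>h\<bar> \<le> 2 * e" for h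
    using r(2) that by (auto simp: e_def dist_real_def subset_iff)
  have int: "integrable \<rho> (\<lambda>x. exp (x * (\<theta> + h)))" if "\<bar>h\<bar> \<le> 2 * e" for h
    using integrable_exp_natural_params[OF sets np[OF that]] .
  have int0: "integrable \<rho> (\<lambda>x. exp (x * \<theta>))" using int[of 0] e by simp
  define G where "G x = exp (x * (\<theta> + 2 * e)) + exp (x * (\<theta> + (- 2 * e)))" for x
  have G: "integrable \<rho> G" unfolding G_def
    by (intro Bochner_Integration.integrable_add int) (use e in auto)
  have bd: "\<bar>exp (x * (\<theta> + h)) - exp (x * \<theta>) - h * (x * exp (x * \<theta>))\<bar> \<le> (h / e)\<^sup>2 * G x"
    if h: "\<bar>h\<bar> \<le> e" for h x
  proof -
    have "exp (x * (\<theta> + h)) - exp (x * \<theta>) - h * (x * exp (x * \<theta>)) =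
        exp (x * \<theta>) * (exp (h * x) - 1 - h * x)"
      by (simp add: algebra_simps exp_add)
    then have "\<bar>exp (x * (\<theta> + h)) - exp (x * \<theta>) - h * (x * exp (x * \<theta>))\<bar> =
        exp (x * \<theta>) * \<bar>exp (h * x) - 1 - h * x\<bar>"
      by (simp add: abs_mult)
    also have "\<dots> \<le> exp (x * \<theta>) * ((h / e)\<^sup>2 * (exp (2 * e * x) + exp (- (2 * e * x))))"
      by (intro mult_left_mono exp_remainder_bound e h) auto
    also have "\<dots> = (h / e)\<^sup>2 * G x"
    proof -
      have "exp (x * (\<theta> + 2 * e)) = exp (x * \<theta>) * exp (2 * e * x)"
        "exp (x * (\<theta> + (- 2 * e))) = exp (x * \<theta>) * exp (- (2 * e * x))"
        unfolding exp_add[symmetric] by (simp_all add: algebra_simps)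
      then show ?thesis unfolding G_def by (simp only: distrib_left mult.left_commute)
    qed
    finally show ?thesis .
  qed
  have "integrable \<rho> (\<lambda>x. exp (x * (\<theta> + e)) - exp (x * \<theta>) - e * (x * exp (x * \<theta>)))"
  proof (rule Bochner_Integration.integrable_bound[OF G])
    show "AE x in \<rho>. norm (exp (x * (\<theta> + e)) - exp (x * \<theta>) - e * (x * exp (x * \<theta>))) \<le> norm (G x)"
      using bd[of e] e by (auto simp: G_def)
  qed simp
  from Bochner_Integration.integrable_diff[OF Bochner_Integration.integrable_diff[OF int[of e] int0] this]
  have "integrable \<rho> (\<lambda>x. e * (x * exp (x * \<theta>)))" using e by simp
  then show X: "integrable \<rho> (\<lambda>x. x * exp (x * \<theta>))" using e by simp
  let ?M = "\<lambda>t. \<integral>x. exp (x * t) \<partial>\<rho>" and ?D = "\<integral>x. x * exp (x * \<theta>) \<partial>\<rho>"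
  define C where "C = (\<integral>x. G x \<partial>\<rho>) / e\<^sup>2"
  have R: "\<bar>?M (\<theta> + h) - ?M \<theta> - h * ?D\<bar> \<le> C * h\<^sup>2" if h: "\<bar>h\<bar> \<le> e" for h
  proof -
    have i: "integrable \<rho> (\<lambda>x. exp (x * (\<theta> + h)))" using int h by simp
    have "?M (\<theta> + h) - ?M \<theta> - h * ?D =
        (\<integral>x. exp (x * (\<theta> + h)) - exp (x * \<theta>) - h * (x * exp (x * \<theta>)) \<partial>\<rho>)"
      using i int0 X by simp
    also have "\<bar>\<dots>\<bar> \<le> (\<integral>x. (h / e)\<^sup>2 * G x \<partial>\<rho>)"
      using i int0 X G bd[OF h]
      by (intro order_trans[OF integral_abs_bound] integral_mono) auto
    also have "\<dots> = C * h\<^sup>2" by (simp add: C_def power_divide)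
    finally show ?thesis .
  qed
  have "((\<lambda>h. (?M (\<theta> + h) - ?M \<theta>) / h - ?D) \<longlongrightarrow> 0) (at 0)"
  proof (rule Lim_null_comparison)
    show "\<forall>\<^sub>F h in at 0. norm ((?M (\<theta> + h) - ?M \<theta>) / h - ?D) \<le> C * \<bar>h\<bar>"
      unfolding eventually_at
    proof (intro exI[of _ e] conjI ballI impI e)
      fix h :: real assume h: "h \<noteq> 0 \<and> dist h 0 < e"
      then have "(?M (\<theta> + h) - ?M \<theta>) / h - ?D = (?M (\<theta> + h) - ?M \<theta> - h * ?D) / h"
        by (simp add: field_simps)
      with R[of h] h show "norm ((?M (\<theta> + h) - ?M \<theta>) / h - ?D) \<le> C * \<bar>h\<bar>"
        by (simp add: pos_divide_le_eq power2_eq_square mult.assoc abs_mult_self_eq)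
    qed
    show "((\<lambda>h. C * \<bar>h\<bar>) \<longlongrightarrow> 0) (at 0)" by (auto intro!: tendsto_eq_intros)
  qed
  then show "(?M has_real_derivative ?D) (at \<theta>)"
    unfolding DERIV_def by (simp add: LIM_zero_iff)
qed

lemma laplace_pos:
  assumes "canonical_exp_family \<rho>" "\<theta> \<in> natural_params \<rho>"
  shows "0 < (\<integral>x. exp (x * \<theta>) \<partial>\<rho>)"
proof -
  have i: "integrable \<rho> (\<lambda>x. exp (x * \<theta>))" and s: "sets \<rho> = sets borel"
    using assms integrable_exp_natural_params by (auto simp: canonical_exp_family_def)
  have "(\<integral>x. exp (x * \<theta>) \<partial>\<rho>) \<noteq> 0"
  proof
    assume "(\<integral>x. exp (x * \<theta>) \<partial>\<rho>) = 0"
    then have "AE x in \<rho>. False"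
      using integral_nonneg_eq_0_iff_AE[OF i] by simp
    then have "(\<integral>x. exp (x * t) \<partial>\<rho>) = 0" for t
      by (intro integral_eq_zero_AE) (auto elim: eventually_mono)
    then have "log_partition \<rho> = (\<lambda>_. ln 0)"
      by (simp add: log_partition_def fun_eq_iff)
    then have "var_fun \<rho> \<theta> = 0" by simp
    with assms show False by (auto simp: canonical_exp_family_def)
  qed
  moreover have "0 \<le> (\<integral>x. exp (x * \<theta>) \<partial>\<rho>)" by simp
  ultimately show ?thesis by linarith
qed

lemma exp_density_eq:
  assumes "canonical_exp_family \<rho>" "\<theta> \<in> natural_params \<rho>"
  shows "exp (x * \<theta> - log_partition \<rho> \<theta>) = exp (x * \<theta>) / (\<integral>x. exp (x * \<theta>) \<partial>\<rho>)"
  using laplace_pos[OF assms] by (simp add: log_partition_def exp_diff)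

lemma prob_space_exp_law:
  assumes "canonical_exp_family \<rho>" "\<theta> \<in> natural_params \<rho>"
  shows "prob_space (exp_law \<rho> \<theta>)"
proof
  have s[measurable_cong]: "sets \<rho> = sets borel" using assms by (simp add: canonical_exp_family_def)
  have i: "integrable \<rho> (\<lambda>x. exp (x * \<theta>))" using integrable_exp_natural_params[OF s assms(2)] .
  have "emeasure (exp_law \<rho> \<theta>) (space (exp_law \<rho> \<theta>)) =
      (\<integral>\<^sup>+x. ennreal (exp (x * \<theta>) / (\<integral>x. exp (x * \<theta>) \<partial>\<rho>)) \<partial>\<rho>)"
    unfolding exp_law_def exp_density_eq[OF assms]
    by (subst emeasure_density) (auto intro!: nn_integral_cong)
  also have "\<dots> = ennreal (\<integral>x. exp (x * \<theta>) / (\<integral>x. exp (x * \<theta>) \<partial>\<rho>) \<partial>\<rho>)"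
    using i by (intro nn_integral_eq_integral) (auto intro!: divide_nonneg_nonneg)
  also have "\<dots> = 1" using laplace_pos[OF assms] by simp
  finally show "emeasure (exp_law \<rho> \<theta>) (space (exp_law \<rho> \<theta>)) = 1" .
qed

lemma
  assumes "canonical_exp_family \<rho>" "\<theta> \<in> natural_params \<rho>"
  shows integrable_exp_law: "integrable (exp_law \<rho> \<theta>) (\<lambda>x. x)"
    and mean_exp_law: "mean_fun \<rho> \<theta> = (\<integral>x. x \<partial>exp_law \<rho> \<theta>)"
    and log_partition_has_derivative:
      "(log_partition \<rho> has_real_derivative (\<integral>x. x \<partial>exp_law \<rho> \<theta>)) (at \<theta>)"
proof -
  have s[measurable_cong]: "sets \<rho> = sets borel" and o: "open (natural_params \<rho>)"
    using assms by (auto simp: canonical_exp_family_def)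
  let ?M = "\<lambda>t. \<integral>x. exp (x * t) \<partial>\<rho>" and ?D = "\<integral>x. x * exp (x * \<theta>) \<partial>\<rho>"
  note p = laplace_pos[OF assms]
  note X = integrable_x_exp[OF s o assms(2)]
  have "integrable \<rho> (\<lambda>x. (exp (x * \<theta>) / ?M \<theta>) *\<^sub>R x)"
    using X by (simp add: mult.commute)
  then show "integrable (exp_law \<rho> \<theta>) (\<lambda>x. x)"
    unfolding exp_law_def exp_density_eq[OF assms]
    using p by (subst integrable_density) auto
  have "(\<integral>x. x \<partial>exp_law \<rho> \<theta>) = (\<integral>x. (exp (x * \<theta>) / ?M \<theta>) *\<^sub>R x \<partial>\<rho>)"
    unfolding exp_law_def exp_density_eq[OF assms]
    using p by (subst integral_density) auto
  then have m: "(\<integral>x. x \<partial>exp_law \<rho> \<theta>) = ?D / ?M \<theta>"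
    by (simp add: mult.commute)
  show d: "(log_partition \<rho> has_real_derivative (\<integral>x. x \<partial>exp_law \<rho> \<theta>)) (at \<theta>)"
    unfolding log_partition_def[abs_def] m
    using has_derivative_laplace[OF s o assms(2)] p
    by (auto intro!: derivative_eq_intros simp: field_simps)
  show "mean_fun \<rho> \<theta> = (\<integral>x. x \<partial>exp_law \<rho> \<theta>)"
    using DERIV_imp_deriv[OF d] .
qed

lemma kl_eq_KL_divergence:
  assumes "canonical_exp_family \<rho>" "\<mu> \<in> mean_set \<rho>" "\<mu>' \<in> mean_set \<rho>"
  shows "kl \<rho> \<mu> \<mu>' = KL_divergence (exp 1) (exp_law \<rho> (param_of_mean \<rho> \<mu>'))
                                             (exp_law \<rho> (param_of_mean \<rho> \<mu>))"
proof -
  define t t' where "t = param_of_mean \<rho> \<mu>" and "t' = param_of_mean \<rho> \<mu>'"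
  have t: "t \<in> natural_params \<rho>" "t' \<in> natural_params \<rho>"
    using assms(2,3) unfolding t_def t'_def param_of_mean_def mean_set_def
    by (auto intro!: inv_into_into)
  have s[measurable_cong]: "sets \<rho> = sets borel" using assms by (simp add: canonical_exp_family_def)
  let ?b = "log_partition \<rho>"
  define h where "h x = x * (t - t') - ?b t + ?b t'" for x
  have [measurable]: "h \<in> borel_measurable borel" by (simp add: h_def[abs_def])
  interpret N: prob_space "exp_law \<rho> t'" using prob_space_exp_law[OF assms(1) t(2)] .
  interpret P: prob_space "exp_law \<rho> t" using prob_space_exp_law[OF assms(1) t(1)] .
  have [measurable_cong]: "sets (exp_law \<rho> t) = sets borel" "sets (exp_law \<rho> t') = sets borel"
    by (simp_all add: exp_law_def s)
  have dens: "exp_law \<rho> t = density (exp_law \<rho> t') (\<lambda>x. ennreal (exp (h x)))"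
    unfolding exp_law_def
    by (subst density_density_eq)
       (auto intro!: arg_cong[where f = "density \<rho>"] simp: fun_eq_iff h_def algebra_simps
          ennreal_mult[symmetric] exp_add[symmetric])
  have "KL_divergence (exp 1) (exp_law \<rho> t') (exp_law \<rho> t) =
      (\<integral>x. exp (h x) * log (exp 1) (exp (h x)) \<partial>exp_law \<rho> t')"
    unfolding dens by (rule N.KL_density) auto
  also have "\<dots> = (\<integral>x. exp (h x) *\<^sub>R h x \<partial>exp_law \<rho> t')"
    by (simp add: log_def)
  also have "\<dots> = (\<integral>x. h x \<partial>exp_law \<rho> t)"
    unfolding dens by (subst integral_density) auto
  also have "\<dots> = mean_fun \<rho> t * (t - t') - ?b t + ?b t'"
    using integrable_exp_law[OF assms(1) t(1)] mean_exp_law[OF assms(1) t(1)]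
    by (simp add: h_def P.prob_space)
  finally show ?thesis
    by (simp add: kl_def t_def t'_def Let_def algebra_simps)
qed

text \<open>
  Extension of the first argument by limits to the finite endpoints of the mean set. Outside
  the closure of the mean set, where an empirical mean lies with probability zero in the
  bounded-variance case, the value is a convention.
\<close>

definition kl_ext :: "real measure \<Rightarrow> real \<Rightarrow> real \<Rightarrow> ereal" where
  "kl_ext \<rho> x \<mu> =
     (if x \<in> mean_set \<rho> then ereal (kl \<rho> x \<mu>)
      else if x \<in> closure (mean_set \<rho>) then Lim (at x within mean_set \<rho>) (\<lambda>y. ereal (kl \<rho> y \<mu>))
      else \<infinity>)"

definition bounded_variance :: "real measure \<Rightarrow> real \<Rightarrow> bool" where
  "bounded_variance \<rho> V \<longleftrightarrow> (\<forall>\<mu>\<in>mean_set \<rho>. var_fun \<rho> (param_of_mean \<rho> \<mu>) \<le> V)"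


section \<open>Bandit models and the bandit game\<close>

definition bandit_model ::
  "real measure \<Rightarrow> real \<Rightarrow> real \<Rightarrow> nat \<Rightarrow> (nat \<Rightarrow> real) \<Rightarrow> bool" where
  "bandit_model \<rho> \<mu>lo \<mu>hi K \<theta> \<longleftrightarrow>
     (\<forall>a\<in>{1..K}. \<theta> a \<in> natural_params \<rho> \<and> mean_fun \<rho> (\<theta> a) \<in> {\<mu>lo..\<mu>hi})"

definition best_mean :: "nat \<Rightarrow> (nat \<Rightarrow> real) \<Rightarrow> real" where
  "best_mean K \<mu> = Max (\<mu> ` {1..K})"

text \<open>
  \<^term>\<open>F t\<close> is the information available to the player after round \<^term>\<open>t\<close>. It contains the
  past actions and rewards and possibly further randomisation of the player (used, for instance,
  to break ties); the last clause says that, given \<^term>\<open>F (t - 1)\<close>, the reward of round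
  \<^term>\<open>t\<close> is a fresh draw from the law of the arm pulled.
\<close>

definition bandit_game ::
  "nat \<Rightarrow> (nat \<Rightarrow> real measure) \<Rightarrow> nat \<Rightarrow> 'w measure \<Rightarrow> (nat \<Rightarrow> 'w measure) \<Rightarrow>
   (nat \<Rightarrow> 'w \<Rightarrow> nat) \<Rightarrow> (nat \<Rightarrow> 'w \<Rightarrow> real) \<Rightarrow> bool" where
  "bandit_game K \<nu> T M F A Y \<longleftrightarrow>
     prob_space M \<and>
     (\<forall>t. subalgebra M (F t)) \<and>
     (\<forall>s t. s \<le> t \<longrightarrow> subalgebra (F t) (F s)) \<and>
     (\<forall>t\<in>{1..T}.
        A t \<in> measurable (F (t - 1)) (count_space {1..K}) \<and>
        Y t \<in> borel_measurable (F t) \<and>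
        (\<forall>S\<in>sets borel.
           AE w in M. real_cond_exp M (F (t - 1)) (\<lambda>w. indicator S (Y t w)) w
             = measure (\<nu> (A t w)) S))"

definition pulls :: "(nat \<Rightarrow> 'w \<Rightarrow> nat) \<Rightarrow> nat \<Rightarrow> nat \<Rightarrow> 'w \<Rightarrow> nat" where
  "pulls A a t w = card {s \<in> {1..t}. A s w = a}"

definition emp_mean ::
  "(nat \<Rightarrow> 'w \<Rightarrow> nat) \<Rightarrow> (nat \<Rightarrow> 'w \<Rightarrow> real) \<Rightarrow> nat \<Rightarrow> nat \<Rightarrow> 'w \<Rightarrow> real" where
  "emp_mean A Y a t w =
     (\<Sum>s=1..t. if A s w = a then Y s w else 0) / real (pulls A a t w)"

definition regret ::
  "nat \<Rightarrow> (nat \<Rightarrow> real) \<Rightarrow> nat \<Rightarrow> 'w measure \<Rightarrow> (nat \<Rightarrow> 'w \<Rightarrow> real) \<Rightarrow> real" where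
  "regret K \<mu> T M Y = real T * best_mean K \<mu> - (\<integral>w. (\<Sum>t=1..T. Y t w) \<partial>M)"


section \<open>The kl-UCB++ algorithm\<close>

definition log_plus :: "real \<Rightarrow> real" where
  "log_plus x = max (ln x) 0"

definition explore :: "nat \<Rightarrow> nat \<Rightarrow> nat \<Rightarrow> real" where
  "explore T K n =
     (let r = real T / (real K * real n) in log_plus (r * ((log_plus r)\<^sup>2 + 1)))"

definition ucb_index ::
  "real measure \<Rightarrow> nat \<Rightarrow> nat \<Rightarrow> (nat \<Rightarrow> 'w \<Rightarrow> nat) \<Rightarrow> (nat \<Rightarrow> 'w \<Rightarrow> real) \<Rightarrow>
   nat \<Rightarrow> nat \<Rightarrow> 'w \<Rightarrow> ereal" where
  "ucb_index \<rho> T K A Y a t w =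
     (let n = pulls A a t w;
          S = {\<mu> \<in> mean_set \<rho>. kl_ext \<rho> (emp_mean A Y a t w) \<mu> \<le> ereal (explore T K n / real n)}
      in if S = {} then ereal (emp_mean A Y a t w) else (SUP \<mu>\<in>S. ereal \<mu>))"

text \<open>
  Since actions take values in \<^term>\<open>{1..K}\<close>, injectivity on the first \<^term>\<open>min K T\<close> rounds
  says that each arm is pulled exactly once during the first \<^term>\<open>K\<close> rounds when
  \<^term>\<open>K \<le> T\<close>, and at most once when the game stops earlier.
\<close>

definition kl_ucb_pp ::
  "real measure \<Rightarrow> nat \<Rightarrow> (nat \<Rightarrow> real) \<Rightarrow> nat \<Rightarrow> 'w measure \<Rightarrow> (nat \<Rightarrow> 'w measure) \<Rightarrow>
   (nat \<Rightarrow> 'w \<Rightarrow> nat) \<Rightarrow> (nat \<Rightarrow> 'w \<Rightarrow> real) \<Rightarrow> bool" where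
  "kl_ucb_pp \<rho> K \<theta> T M F A Y \<longleftrightarrow>
     bandit_game K (\<lambda>a. exp_law \<rho> (\<theta> a)) T M F A Y \<and>
     (\<forall>w\<in>space M.
        inj_on (\<lambda>t. A t w) {1..min K T} \<and>
        (\<forall>t\<in>{K..<T}. \<forall>a\<in>{1..K}.
           ucb_index \<rho> T K A Y a t w \<le> ucb_index \<rho> T K A Y (A (t + 1) w) t w))"

end

theory Submission
  imports Defs "HOL-Real_Asymp.Real_Asymp"
begin

text \<open>
  Bounded variance forces the natural parameter set to be the whole line, and the divergence,
  with its extension to the boundary, is then a supremum of affine functions of its first
  argument, namely of the log-likelihood ratios. Exponentials of the summed log-likelihood ratios of
  one arm are martingales, so Ville's inequality controls the empirical mean of that arm uniformly
  over all times at which it has been pulled at least \<open>k\<close> times; no reordering of the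
  rewards is needed.

  Put \<open>D = \<delta>\<^sup>2 / (2 V)\<close>. The index of an optimal arm stays above \<open>\<mu>\<^sup>\<star> - \<delta>\<close> outside an event of probability
  \<open>O(K / (T D))\<close>. Off this event, each pull of a suboptimal arm \<open>a\<close> after initialisation happens
  either at a pull count at most \<open>(log T + O(log log T)) / kl (\<mu>\<^sub>a + \<delta>) (\<mu>\<^sup>\<star> - \<delta>)\<close>, or while the empirical mean of \<open>a\<close>
  exceeds \<open>\<mu>\<^sub>a + \<delta>\<close>; the latter costs at most \<open>1 / D\<close> pulls in expectation. For the regret, take
  \<open>\<delta> = (log T)\<^bsup>-1/4\<^esup>\<close>.
\<close>

section \<open>Exponential families of bounded variance\<close>

text \<open>On the exceptional event of the optimal arm all T rounds are charged, so its probability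
  must be of order K / (T D) uniformly in \<delta>, without a further factor of 1 / D or log T. A
  union bound over single pull counts n, each costing about exp (- g(n)) with g the exploration
  rate, loses another factor 1 / D up to logarithms. Peeling with a fixed ratio of counts shrinks
  the exponent by a constant factor, which loses a power of T / (K n). The grid therefore refines as
  n decreases, and the squared logarithm inside g keeps the growing number of blocks summable.
  Working with suprema of affine functions makes every statement about the index hold at each real
  empirical mean, also on the null set where it leaves the closure of the mean set. The log log T of
  the claim stems from the summand \<open>ln (1 + (ln T)^2)\<close> of the exploration rate, divided
  by a divergence that is at least D.\<close>

lemma is_interval_natural_params:
  assumes "sets \<rho> = sets borel"
  shows "is_interval (natural_params \<rho>)"
  unfolding is_interval_1
proof (intro ballI allI impI)
  have [measurable_cong]: "sets \<rho> = sets borel" by fact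
  fix a b t :: real assume a: "a \<in> natural_params \<rho>" and b: "b \<in> natural_params \<rho>" and t: "a \<le> t \<and> t \<le> b"
  have "(\<integral>\<^sup>+x. ennreal (exp (x * t)) \<partial>\<rho>)
      \<le> (\<integral>\<^sup>+x. (ennreal (exp (x * a)) + ennreal (exp (x * b))) \<partial>\<rho>)"
  proof (rule nn_integral_mono)
    fix x :: real
    have "x * t \<le> x * a \<or> x * t \<le> x * b"
      using t by (cases "x \<ge> 0") (auto simp: mult_left_mono mult_left_mono_neg)
    then have "exp (x * t) \<le> exp (x * a) + exp (x * b)"
    proof
      assume "x * t \<le> x * a"
      then have "exp (x * t) \<le> exp (x * a)" by simp
      then show ?thesis using exp_ge_zero[of "x * b"] by linarith
    next
      assume "x * t \<le> x * b"
      then have "exp (x * t) \<le> exp (x * b)" by simp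
      then show ?thesis using exp_ge_zero[of "x * a"] by linarith
    qed
    then show "ennreal (exp (x * t)) \<le> ennreal (exp (x * a)) + ennreal (exp (x * b))"
      by (simp add: ennreal_plus[symmetric] del: ennreal_plus)
  qed
  also have "\<dots> = (\<integral>\<^sup>+x. ennreal (exp (x * a)) \<partial>\<rho>) + (\<integral>\<^sup>+x. ennreal (exp (x * b)) \<partial>\<rho>)"
    by (rule nn_integral_add) auto
  also have "\<dots> < \<infinity>" using a b by (simp add: natural_params_def)
  finally show "t \<in> natural_params \<rho>" by (simp add: natural_params_def)
qed

text \<open>The weights \<open>1 + max x 0\<close> and \<open>1 + max (-x) 0\<close> differ by \<open>x\<close> and leave the natural
  parameters unchanged, so differentiability of the first moment reduces to that of two
  Laplace transforms.\<close>

lemma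
  fixes w :: "real \<Rightarrow> real"
  assumes sets: "sets \<rho> = sets borel" and op: "open (natural_params \<rho>)"
    and w: "w \<in> borel_measurable borel" "\<And>x. 1 \<le> w x" "\<And>x. w x \<le> 1 + \<bar>x\<bar>"
  shows natural_params_weighted: "natural_params (density \<rho> (\<lambda>x. ennreal (w x))) = natural_params \<rho>"
    and laplace_weighted: "(\<integral>x. exp (x * t) \<partial>density \<rho> (\<lambda>x. ennreal (w x))) = (\<integral>x. w x * exp (x * t) \<partial>\<rho>)"
    and integrable_weighted: "t \<in> natural_params \<rho> \<Longrightarrow> integrable \<rho> (\<lambda>x. w x * exp (x * t))"
proof -
  have [measurable_cong]: "sets \<rho> = sets borel" by fact
  note w(1)[measurable]
  have w0: "0 \<le> w x" for x using w(2)[of x] by linarith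
  show int: "integrable \<rho> (\<lambda>x. w x * exp (x * t))" if "t \<in> natural_params \<rho>" for t
  proof (rule Bochner_Integration.integrable_bound)
    show "integrable \<rho> (\<lambda>x. exp (x * t) + \<bar>x * exp (x * t)\<bar>)"
      using integrable_exp_natural_params[OF sets that] integrable_x_exp[OF sets op that]
      by (intro Bochner_Integration.integrable_add integrable_abs)
    have "w x * exp (x * t) \<le> (1 + \<bar>x\<bar>) * exp (x * t)" for x
      by (intro mult_right_mono w) auto
    then have "\<bar>w x * exp (x * t)\<bar> \<le> \<bar>exp (x * t) + \<bar>x * exp (x * t)\<bar>\<bar>" for x
      using w0[of x] by (simp add: abs_mult distrib_right)
    then show "AE x in \<rho>. norm (w x * exp (x * t)) \<le> norm (exp (x * t) + \<bar>x * exp (x * t)\<bar>)"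
      by simp
  qed simp
  have nn: "(\<integral>\<^sup>+x. ennreal (exp (x * t)) \<partial>density \<rho> (\<lambda>x. ennreal (w x))) = (\<integral>\<^sup>+x. ennreal (w x * exp (x * t)) \<partial>\<rho>)" for t
    by (subst nn_integral_density) (auto simp: ennreal_mult' w0 intro!: nn_integral_cong)
  show "natural_params (density \<rho> (\<lambda>x. ennreal (w x))) = natural_params \<rho>"
  proof (intro set_eqI iffI)
    fix t assume "t \<in> natural_params (density \<rho> (\<lambda>x. ennreal (w x)))"
    then have "(\<integral>\<^sup>+x. ennreal (w x * exp (x * t)) \<partial>\<rho>) < \<infinity>" by (simp add: natural_params_def nn)
    moreover have "exp (x * t) \<le> w x * exp (x * t)" for x
      using mult_right_mono[OF w(2)[of x], of "exp (x * t)"] by simp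
    then have "(\<integral>\<^sup>+x. ennreal (exp (x * t)) \<partial>\<rho>) \<le> (\<integral>\<^sup>+x. ennreal (w x * exp (x * t)) \<partial>\<rho>)"
      by (intro nn_integral_mono ennreal_leI)
    ultimately show "t \<in> natural_params \<rho>" by (simp add: natural_params_def)
  next
    fix t assume "t \<in> natural_params \<rho>"
    from int[OF this] show "t \<in> natural_params (density \<rho> (\<lambda>x. ennreal (w x)))"
      by (auto simp: natural_params_def nn nn_integral_eq_integral w0)
  qed
  show "(\<integral>x. exp (x * t) \<partial>density \<rho> (\<lambda>x. ennreal (w x))) = (\<integral>x. w x * exp (x * t) \<partial>\<rho>)"
    by (subst integral_density) (auto simp: w0)
qed

lemma first_moment_differentiable:
  fixes \<rho> :: "real measure"
  assumes sets: "sets \<rho> = sets borel" and op: "open (natural_params \<rho>)"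
    and th: "\<theta> \<in> natural_params \<rho>"
  shows "\<exists>D. ((\<lambda>t. \<integral>x. x * exp (x * t) \<partial>\<rho>) has_real_derivative D) (at \<theta>)"
proof -
  define wp wm :: "real \<Rightarrow> real" where "wp x = 1 + max x 0" and "wm x = 1 + max (- x) 0" for x
  have wp: "wp \<in> borel_measurable borel" "\<And>x. 1 \<le> wp x" "\<And>x. wp x \<le> 1 + \<bar>x\<bar>"
    and wm: "wm \<in> borel_measurable borel" "\<And>x. 1 \<le> wm x" "\<And>x. wm x \<le> 1 + \<bar>x\<bar>"
    by (auto simp: wp_def[abs_def] wm_def[abs_def])
  let ?D = "\<lambda>w. density \<rho> (\<lambda>x. ennreal (w x))"
  have d: "\<exists>D. ((\<lambda>t. \<integral>x. w x * exp (x * t) \<partial>\<rho>) has_real_derivative D) (at \<theta>)"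
    if w: "w \<in> borel_measurable borel" "\<And>x. 1 \<le> w x" "\<And>x. w x \<le> 1 + \<bar>x\<bar>" for w :: "real \<Rightarrow> real"
    \<comment> \<open>This rule asks only for Borel sets and open natural parameters, so it applies
      to the reweighted base measure, whatever its variance.\<close>
    using has_derivative_laplace[of "?D w" \<theta>]
    unfolding natural_params_weighted[OF sets op w] laplace_weighted[OF sets op w]
    using sets op th by auto
  obtain D1 D2 where D: "((\<lambda>t. \<integral>x. wp x * exp (x * t) \<partial>\<rho>) has_real_derivative D1) (at \<theta>)"
    "((\<lambda>t. \<integral>x. wm x * exp (x * t) \<partial>\<rho>) has_real_derivative D2) (at \<theta>)"
    using d[OF wp] d[OF wm] by blast
  have eq: "(\<integral>x. wp x * exp (x * t) \<partial>\<rho>) - (\<integral>x. wm x * exp (x * t) \<partial>\<rho>) = (\<integral>x. x * exp (x * t) \<partial>\<rho>)"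
    if "t \<in> natural_params \<rho>" for t
    using integrable_weighted[OF sets op wp that] integrable_weighted[OF sets op wm that]
    by (subst Bochner_Integration.integral_diff[symmetric])
       (auto intro!: Bochner_Integration.integral_cong simp: wp_def wm_def algebra_simps max_def)
  have "((\<lambda>t. \<integral>x. x * exp (x * t) \<partial>\<rho>) has_real_derivative (D1 - D2)) (at \<theta>)"
    by (rule has_field_derivative_transform_within_open[OF DERIV_diff[OF D] op th]) (simp add: eq)
  then show ?thesis by blast
qed

text \<open>\<open>var_fun\<close> is a value of \<open>deriv\<close>; only differentiability turns
  its positivity and its bound by V into information on the slope of the mean map.\<close>

lemma mean_fun_has_derivative:
  assumes fam: "canonical_exp_family \<rho>" and th: "\<theta> \<in> natural_params \<rho>"
  shows "(mean_fun \<rho> has_real_derivative var_fun \<rho> \<theta>) (at \<theta>)"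
proof -
  have s: "sets \<rho> = sets borel" and o: "open (natural_params \<rho>)"
    using fam by (auto simp: canonical_exp_family_def)
  let ?M = "\<lambda>t. \<integral>x. exp (x * t) \<partial>\<rho>" and ?D = "\<lambda>t. \<integral>x. x * exp (x * t) \<partial>\<rho>"
  have m: "mean_fun \<rho> t = ?D t / ?M t" if "t \<in> natural_params \<rho>" for t
  proof -
    have "(log_partition \<rho> has_real_derivative ?D t / ?M t) (at t)"
      unfolding log_partition_def[abs_def]
      using has_derivative_laplace[OF s o that] laplace_pos[OF fam that]
      by (auto intro!: derivative_eq_intros simp: field_simps)
    then show ?thesis by (rule DERIV_imp_deriv)
  qed
  obtain E where E: "(?D has_real_derivative E) (at \<theta>)"
    using first_moment_differentiable[OF s o th] by blast
  have "((\<lambda>t. ?D t / ?M t) has_real_derivative (E * ?M \<theta> - ?D \<theta> * ?D \<theta>) / (?M \<theta> * ?M \<theta>)) (at \<theta>)"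
    using laplace_pos[OF fam th] by (intro DERIV_divide E has_derivative_laplace[OF s o th]) simp
  then have "(mean_fun \<rho> has_real_derivative (E * ?M \<theta> - ?D \<theta> * ?D \<theta>) / (?M \<theta> * ?M \<theta>)) (at \<theta>)"
    by (rule has_field_derivative_transform_within_open[OF _ o th]) (simp add: m)
  then show ?thesis using DERIV_imp_deriv by fastforce
qed

text \<open>By the mean value theorem f does not increase before c and does not decrease after it,
  so its value 0 at c is a minimum. This serves all the calculus inequalities below.\<close>

lemma nonneg_of_deriv_sign:
  fixes f f' :: "real \<Rightarrow> real"
  assumes "is_interval S" "c \<in> S" "x \<in> S" "f c = 0"
    and "\<And>t. t \<in> S \<Longrightarrow> (f has_real_derivative f' t) (at t)"
    and "\<And>t. t \<in> S \<Longrightarrow> 0 \<le> f' t * (t - c)"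
  shows "0 \<le> f x"
proof (cases x c rule: linorder_cases)
  case equal with assms show ?thesis by simp
next
  case less
  have S: "t \<in> S" if "x \<le> t" "t \<le> c" for t
    using assms(1,2,3) that unfolding is_interval_1 by blast
  obtain z where z: "x < z" "z < c" "f c - f x = (c - x) * f' z"
    using MVT2[OF less, of f f'] assms(5) S by blast
  have "f' z \<le> 0" using assms(6)[OF S[of z]] z by (simp add: zero_le_mult_iff)
  then have "(c - x) * f' z \<le> 0" using less by (simp add: mult_nonneg_nonpos)
  with z(3) assms(4) show ?thesis by simp
next
  case greater
  have S: "t \<in> S" if "c \<le> t" "t \<le> x" for t
    using assms(1,2,3) that unfolding is_interval_1 by blast
  obtain z where z: "c < z" "z < x" "f x - f c = (x - c) * f' z"
    using MVT2[OF greater, of f f'] assms(5) S by blast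
  have "0 \<le> f' z" using assms(6)[OF S[of z]] z by (simp add: zero_le_mult_iff)
  then have "0 \<le> (x - c) * f' z" using greater by simp
  with z(3) assms(4) show ?thesis by simp
qed

section \<open>Consequences of bounded variance\<close>

locale bounded_exp_family =
  fixes \<rho> :: "real measure" and V :: real
  assumes fam: "canonical_exp_family \<rho>" and V_pos: "0 < V" and var_bounded: "bounded_variance \<rho> V"
begin

abbreviation "b \<equiv> log_partition \<rho>"
abbreviation "m \<equiv> mean_fun \<rho>"

lemma sets_base: "sets \<rho> = sets borel"
  and open_natural_params: "open (natural_params \<rho>)"
  and natural_params_nonempty: "natural_params \<rho> \<noteq> {}"
  and var_pos: "\<theta> \<in> natural_params \<rho> \<Longrightarrow> 0 < var_fun \<rho> \<theta>"
  using fam by (auto simp: canonical_exp_family_def)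

lemma strict_mono_on_mean: "strict_mono_on (natural_params \<rho>) m"
proof (rule strict_mono_onI)
  fix r s assume rs: "r \<in> natural_params \<rho>" "s \<in> natural_params \<rho>" "r < s"
  have S: "t \<in> natural_params \<rho>" if "r \<le> t" "t \<le> s" for t
    using is_interval_natural_params[OF sets_base] rs(1,2) that unfolding is_interval_1 by blast
  obtain z where z: "r < z" "z < s" "m s - m r = (s - r) * var_fun \<rho> z"
    using MVT2[OF rs(3), of m "var_fun \<rho>"] mean_fun_has_derivative[OF fam] S by blast
  have "0 < (s - r) * var_fun \<rho> z" using var_pos[OF S[of z]] z rs(3) by simp
  with z(3) show "m r < m s" by simp
qed

lemma var_le:
  assumes "\<theta> \<in> natural_params \<rho>" shows "var_fun \<rho> \<theta> \<le> V"
proof -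
  have "param_of_mean \<rho> (m \<theta>) = \<theta>"
    unfolding param_of_mean_def
    by (rule inv_into_f_f[OF strict_mono_on_imp_inj_on[OF strict_mono_on_mean] assms])
  with var_bounded assms show ?thesis
    unfolding bounded_variance_def mean_set_def by force
qed

lemma b_has_derivative: "\<theta> \<in> natural_params \<rho> \<Longrightarrow> (b has_real_derivative m \<theta>) (at \<theta>)"
  using log_partition_has_derivative[OF fam] mean_exp_law[OF fam] by simp

text \<open>The mean map is V-Lipschitz, and comparing derivatives once more puts a parabola above
  the log-partition function. Its finiteness at limit points is what closes the parameter
  set.\<close>

lemma quadratic_bound:
  assumes "c \<in> natural_params \<rho>" "x \<in> natural_params \<rho>"
  shows "b x \<le> b c + m c * (x - c) + V / 2 * (x - c)\<^sup>2"
proof -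
  have *: "\<bar>m t - m c\<bar> \<le> V * \<bar>t - c\<bar>" if t: "t \<in> natural_params \<rho>" for t
  proof -
    have "norm (m t - m c) \<le> V * norm (t - c)"
    proof (rule field_differentiable_bound[of "natural_params \<rho>" m "var_fun \<rho>" V])
      show "convex (natural_params \<rho>)"
        using is_interval_natural_params[OF sets_base] is_interval_convex by blast
      show "(m has_field_derivative var_fun \<rho> z) (at z within natural_params \<rho>)"
        if "z \<in> natural_params \<rho>" for z
        using mean_fun_has_derivative[OF fam that] by (rule has_field_derivative_at_within)
      show "norm (var_fun \<rho> z) \<le> V" if "z \<in> natural_params \<rho>" for z
        using var_le[OF that] var_pos[OF that] by simp
    qed (use assms t in auto)
    then show ?thesis by simp
  qed
  have "0 \<le> b c + m c * (x - c) + V / 2 * (x - c)\<^sup>2 - b x"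
  proof (rule nonneg_of_deriv_sign[where f = "\<lambda>x. b c + m c * (x - c) + V / 2 * (x - c)\<^sup>2 - b x"
        and c = c and f' = "\<lambda>t. V * (t - c) - (m t - m c)"])
    fix t assume t: "t \<in> natural_params \<rho>"
    show "((\<lambda>x. b c + m c * (x - c) + V / 2 * (x - c)\<^sup>2 - b x) has_real_derivative
        V * (t - c) - (m t - m c)) (at t)"
      by (auto intro!: derivative_eq_intros b_has_derivative[OF t])
    have "(m t - m c) * (t - c) \<le> V * \<bar>t - c\<bar> * \<bar>t - c\<bar>"
      using mult_right_mono[OF *[OF t], of "\<bar>t - c\<bar>"] abs_le_D1[of "(m t - m c) * (t - c)"]
      by (simp add: abs_mult)
    then show "0 \<le> (V * (t - c) - (m t - m c)) * (t - c)"
      by (simp add: algebra_simps)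
  qed (use assms is_interval_natural_params[OF sets_base] in auto)
  then show ?thesis by simp
qed

text \<open>Along a convergent sequence of natural parameters the Laplace transforms stay below the
  exponential of a parabola, so by Fatou the limit is natural too. The set is then open, closed and
  nonempty in a connected space.\<close>

lemma natural_params_UNIV: "natural_params \<rho> = UNIV"
proof -
  have [measurable_cong]: "sets \<rho> = sets borel" by (rule sets_base)
  have "closed (natural_params \<rho>)"
    unfolding closed_sequential_limits
  proof (intro allI impI, elim conjE)
    fix s l assume s: "\<forall>n. s n \<in> natural_params \<rho>" and lim: "s \<longlonglongrightarrow> l"
    obtain c where c: "c \<in> natural_params \<rho>" using natural_params_nonempty by blast
    define q where "q x = exp (b c + m c * (x - c) + V / 2 * (x - c)\<^sup>2)" for x
    have int: "(\<integral>\<^sup>+x. ennreal (exp (x * s n)) \<partial>\<rho>) \<le> ennreal (q (s n))" for n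
    proof -
      have sn: "s n \<in> natural_params \<rho>" using s by blast
      have "(\<integral>\<^sup>+x. ennreal (exp (x * s n)) \<partial>\<rho>) = ennreal (\<integral>x. exp (x * s n) \<partial>\<rho>)"
        by (rule nn_integral_eq_integral[OF integrable_exp_natural_params[OF sets_base sn]]) simp
      also have "(\<integral>x. exp (x * s n) \<partial>\<rho>) = exp (b (s n))"
        using laplace_pos[OF fam sn] by (simp add: log_partition_def)
      also have "\<dots> \<le> q (s n)"
        using quadratic_bound[OF c sn] by (simp add: q_def)
      finally show ?thesis by (simp add: ennreal_leI)
    qed
    have "(\<integral>\<^sup>+x. ennreal (exp (x * l)) \<partial>\<rho>) = (\<integral>\<^sup>+x. liminf (\<lambda>n. ennreal (exp (x * s n))) \<partial>\<rho>)"
    proof (intro nn_integral_cong)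
      fix x :: real
      have "(\<lambda>n. ennreal (exp (x * s n))) \<longlonglongrightarrow> ennreal (exp (x * l))"
        by (intro tendsto_ennrealI tendsto_intros lim)
      then show "ennreal (exp (x * l)) = liminf (\<lambda>n. ennreal (exp (x * s n)))"
        by (intro lim_imp_Liminf[symmetric]) simp
    qed
    also have "\<dots> \<le> liminf (\<lambda>n. \<integral>\<^sup>+x. ennreal (exp (x * s n)) \<partial>\<rho>)"
      by (rule nn_integral_liminf) auto
    also have "\<dots> \<le> liminf (\<lambda>n. ennreal (q (s n)))"
      by (rule Liminf_mono) (simp add: int)
    also have "\<dots> = ennreal (q l)"
    proof (rule lim_imp_Liminf)
      show "(\<lambda>n. ennreal (q (s n))) \<longlonglongrightarrow> ennreal (q l)"
        unfolding q_def by (intro tendsto_ennrealI tendsto_intros lim)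
    qed simp
    also have "\<dots> < \<infinity>" by simp
    finally show "l \<in> natural_params \<rho>" by (simp add: natural_params_def)
  qed
  then show ?thesis using clopen open_natural_params natural_params_nonempty by blast
qed

lemma strict_mono_mean: "strict_mono m"
  using strict_mono_on_mean natural_params_UNIV by simp

lemma param_of_mean_mean [simp]: "param_of_mean \<rho> (m \<theta>) = \<theta>"
  unfolding param_of_mean_def natural_params_UNIV
  using strict_mono_mean by (simp add: strict_mono_imp_inj_on)

lemma mean_set_eq: "mean_set \<rho> = range m"
  by (simp add: mean_set_def natural_params_UNIV)

lemma b_deriv: "(b has_real_derivative m \<theta>) (at \<theta>)"
  by (rule b_has_derivative) (simp add: natural_params_UNIV)

lemma m_deriv: "(m has_real_derivative var_fun \<rho> \<theta>) (at \<theta>)"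
  by (rule mean_fun_has_derivative[OF fam]) (simp add: natural_params_UNIV)

lemma kl_mean: "kl \<rho> (m s) (m t) = b t - b s - m s * (t - s)"
  by (simp add: kl_def Let_def)

lemma tangent_le: "b s + m s * (t - s) \<le> b t"
proof -
  have "0 \<le> b t - (b s + m s * (t - s))"
  proof (rule nonneg_of_deriv_sign[where f = "\<lambda>t. b t - (b s + m s * (t - s))" and S = UNIV
        and c = s and f' = "\<lambda>t. m t - m s"])
    fix t show "((\<lambda>t. b t - (b s + m s * (t - s))) has_real_derivative m t - m s) (at t)"
      by (auto intro!: derivative_eq_intros b_deriv)
    show "0 \<le> (m t - m s) * (t - s)"
      using strict_mono_less_eq[OF strict_mono_mean, of t s]
        strict_mono_less_eq[OF strict_mono_mean, of s t]
      by (cases "t \<le> s") (auto simp: zero_le_mult_iff)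
  qed auto
  then show ?thesis by simp
qed

text \<open>As functions of the second natural parameter t both sides vanish at s. The derivative of
  their difference is \<open>(m t - m s) * (1 - var_fun \<rho> t / V)\<close>, which has the sign of
  t - s because the variance is at most V.\<close>

lemma kl_ge_square:
  assumes "x \<in> mean_set \<rho>" "y \<in> mean_set \<rho>"
  shows "(x - y)\<^sup>2 / (2 * V) \<le> kl \<rho> x y"
proof -
  obtain s t where st: "x = m s" "y = m t" using assms by (auto simp: mean_set_eq)
  have "0 \<le> b t - b s - m s * (t - s) - (m s - m t)\<^sup>2 / (2 * V)"
  proof (rule nonneg_of_deriv_sign[where f = "\<lambda>t. b t - b s - m s * (t - s) - (m s - m t)\<^sup>2 / (2 * V)"
        and S = UNIV and c = s and f' = "\<lambda>t. (m t - m s) * (1 - var_fun \<rho> t / V)"])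
    fix t show "((\<lambda>t. b t - b s - m s * (t - s) - (m s - m t)\<^sup>2 / (2 * V)) has_real_derivative
        (m t - m s) * (1 - var_fun \<rho> t / V)) (at t)"
      using V_pos by (auto intro!: derivative_eq_intros b_deriv m_deriv simp: field_simps)
    have "0 \<le> 1 - var_fun \<rho> t / V"
      using var_le[of t] V_pos by (simp add: natural_params_UNIV)
    moreover have "0 \<le> (m t - m s) * (t - s)"
      using strict_mono_less_eq[OF strict_mono_mean, of t s]
        strict_mono_less_eq[OF strict_mono_mean, of s t]
      by (cases "t \<le> s") (auto simp: zero_le_mult_iff)
    ultimately have "0 \<le> (1 - var_fun \<rho> t / V) * ((m t - m s) * (t - s))" by simp
    then show "0 \<le> (m t - m s) * (1 - var_fun \<rho> t / V) * (t - s)"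
      by (simp add: mult_ac)
  qed auto
  then show ?thesis by (simp add: st kl_mean)
qed

end


section \<open>The divergence and the index\<close>

text \<open>The index depends on the history only through the empirical mean and the ratio of
  exploration rate to pull count; separating these two arguments makes its analysis
  deterministic.\<close>

definition index_of :: "real measure \<Rightarrow> real \<Rightarrow> real \<Rightarrow> ereal" where
  "index_of \<rho> x c =
     (let S = {\<mu> \<in> mean_set \<rho>. kl_ext \<rho> x \<mu> \<le> ereal c}
      in if S = {} then ereal x else (SUP \<mu>\<in>S. ereal \<mu>))"

lemma ucb_index_eq:
  "ucb_index \<rho> T K A Y a t w =
     index_of \<rho> (emp_mean A Y a t w) (explore T K (pulls A a t w) / real (pulls A a t w))"
  by (simp add: ucb_index_def index_of_def Let_def)

context bounded_exp_family
begin

text \<open>The log-likelihood ratio of \<open>exp_law \<rho> s\<close> against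
  \<open>exp_law \<rho> t\<close> at one observation. Being affine in x, its sum over n draws is n
  times its value at their empirical mean.\<close>

definition log_ratio :: "real \<Rightarrow> real \<Rightarrow> real \<Rightarrow> real" where
  "log_ratio t s x = (s - t) * x - (b s - b t)"

lemma log_ratio_mean: "log_ratio t s (m s) = kl \<rho> (m s) (m t)"
  by (simp add: log_ratio_def kl_mean algebra_simps)

lemma log_ratio_le_kl: "log_ratio t s (m u) \<le> kl \<rho> (m u) (m t)"
  using tangent_le[of u s] by (simp add: log_ratio_def kl_mean algebra_simps)

lemma log_ratio_ge: "(s - t) * (x - m s) \<le> log_ratio t s x"
  using tangent_le[of s t] by (simp add: log_ratio_def algebra_simps)

lemma kl_nonneg: "0 \<le> kl \<rho> (m s) (m t)"
  using tangent_le[of s t] by (simp add: kl_mean algebra_simps)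

lemma not_in_range_mean:
  assumes "x \<notin> range m" shows "(\<forall>s. m s < x) \<or> (\<forall>s. x < m s)"
proof -
  have "continuous_on UNIV m"
    by (rule DERIV_continuous_on) (rule has_field_derivative_at_within[OF m_deriv])
  then have "is_interval (range m)"
    by (simp add: is_interval_connected_1 connected_continuous_image)
  then have "m s \<le> x \<Longrightarrow> x \<le> m t \<Longrightarrow> x \<in> range m" for s t
    unfolding is_interval_1 by blast
  moreover have "m s < x \<or> x < m s" for s
    using assms by (metis linorder_neq_iff rangeI)
  ultimately show ?thesis using assms by (meson less_imp_le)
qed

text \<open>The right-hand side is the Legendre dual form of the divergence; the junk value \<open>\<infinity>\<close> chosen
  in \<^const>\<open>kl_ext\<close> outside the closure of the mean set agrees with it.\<close>

lemma kl_ext_eq_SUP: "kl_ext \<rho> x (m t) = (SUP s. ereal (log_ratio t s x))"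
proof -
  consider (inside) u where "x = m u" | (outside) "x \<notin> closure (range m)"
    | (boundary) "x \<notin> range m" "x \<in> closure (range m)" by blast
  then show ?thesis
  proof cases
    case inside
    have "(SUP s. ereal (log_ratio t s x)) = ereal (kl \<rho> (m u) (m t))"
    proof (rule antisym)
      show "(SUP s. ereal (log_ratio t s x)) \<le> ereal (kl \<rho> (m u) (m t))"
        by (rule SUP_least) (simp add: inside log_ratio_le_kl)
      show "ereal (kl \<rho> (m u) (m t)) \<le> (SUP s. ereal (log_ratio t s x))"
        by (rule SUP_upper2[of u]) (simp_all add: inside log_ratio_mean)
    qed
    then show ?thesis by (simp add: kl_ext_def mean_set_eq inside)
  next
    case outside
    then obtain e where e: "0 < e" "\<And>s. e \<le> dist (m s) x"
      unfolding closure_approachable by (meson not_less rangeI)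
    have nr: "x \<notin> range m" using outside closure_subset[of "range m"] by (rule contra_subsetD[rotated])
    \<comment> \<open>The sign points from the mean set towards x. Moving the tilt s in that
      direction raises the log-ratio at rate at least e, hence beyond every B.\<close>
    define \<sigma> where "\<sigma> = (if \<forall>s. m s < x then 1 else - 1 :: real)"
    have \<sigma>: "e \<le> \<sigma> * (x - m s)" for s
    proof (cases "\<forall>s. m s < x")
      case True
      with e(2)[of s] show ?thesis by (simp add: \<sigma>_def dist_real_def abs_of_neg)
    next
      case False
      with not_in_range_mean[OF nr] have "x < m s" by blast
      moreover have "\<sigma> = - 1" unfolding \<sigma>_def using False by (rule if_not_P)
      ultimately show ?thesis using e(2)[of s] by (simp add: dist_real_def abs_of_pos)
    qed
    have "(SUP s. ereal (log_ratio t s x)) = \<infinity>"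
    proof (rule ereal_top)
      fix B :: real
      define s where "s = t + \<sigma> * (\<bar>B\<bar> / e)"
      have "B \<le> \<bar>B\<bar> / e * e" using e(1) by simp
      also have "\<dots> \<le> \<bar>B\<bar> / e * (\<sigma> * (x - m s))" using e(1) \<sigma> by (intro mult_left_mono) auto
      also have "\<dots> = (s - t) * (x - m s)" by (simp add: s_def)
      also have "\<dots> \<le> log_ratio t s x" by (rule log_ratio_ge)
      finally show "ereal B \<le> (SUP s. ereal (log_ratio t s x))" by (intro SUP_upper2[of s]) auto
    qed
    with outside nr show ?thesis by (simp add: kl_ext_def mean_set_eq)
  next
    case boundary
    let ?F = "SUP s. ereal (log_ratio t s x)"
    have ev: "eventually P (at x within range m)"
      if "\<exists>d>0. \<forall>u. \<bar>m u - x\<bar> < d \<longrightarrow> P (m u)" for P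
      using that unfolding eventually_at by (force simp: dist_real_def)
    have "((\<lambda>y. ereal (kl \<rho> y (m t))) \<longlongrightarrow> ?F) (at x within range m)"
    proof (rule order_tendstoI)
      fix a assume "a < ?F"
      \<comment> \<open>Lower half of the limit: a single affine function already exceeds a at x,
        and it is continuous and below the divergence.\<close>
      then obtain s where s: "a < ereal (log_ratio t s x)" by (auto simp: less_SUP_iff)
      have "((\<lambda>y. ereal (log_ratio t s y)) \<longlongrightarrow> ereal (log_ratio t s x)) (at x within range m)"
        unfolding log_ratio_def by (intro tendsto_intros)
      then have "\<forall>\<^sub>F y in at x within range m. a < ereal (log_ratio t s y)"
        using s by (rule order_tendstoD)
      moreover have "\<forall>\<^sub>F y in at x within range m. y \<in> range m"
        by (simp add: eventually_at_filter)
      ultimately show "\<forall>\<^sub>F y in at x within range m. a < ereal (kl \<rho> y (m t))"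
      proof eventually_elim
        case (elim y)
        then obtain u where "y = m u" by blast
        with elim show ?case using log_ratio_le_kl[of t s u] by (auto intro: less_le_trans)
      qed
    next
      fix a assume a: "?F < a"
      show "\<forall>\<^sub>F y in at x within range m. ereal (kl \<rho> y (m t)) < a"
      proof (rule ev, intro exI[of _ "\<bar>m t - x\<bar>"] conjI allI impI)
        show "0 < \<bar>m t - x\<bar>" using boundary by auto
        \<comment> \<open>Upper half of the limit: \<open>m u\<close> lies strictly between
          \<open>m t\<close> and x, so the affine function that attains the divergence at
          \<open>m u\<close> can only grow on the way to x.\<close>
        fix u assume u: "\<bar>m u - x\<bar> < \<bar>m t - x\<bar>"
        have "0 \<le> (u - t) * (x - m u)"
          using not_in_range_mean[OF boundary(1)]
        proof
          assume "\<forall>s. m s < x"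
          then have "m u < x" "m t < x" by auto
          with u have "m u < x" "m t < m u" by (simp_all add: abs_if)
          then show ?thesis using strict_mono_less[OF strict_mono_mean] by simp
        next
          assume "\<forall>s. x < m s"
          then have "x < m u" "x < m t" by auto
          with u have "x < m u" "m u < m t" by (simp_all add: abs_if)
          then show ?thesis using strict_mono_less[OF strict_mono_mean] by (simp add: mult_nonpos_nonpos)
        qed
        then have "log_ratio t u (m u) \<le> log_ratio t u x"
          by (simp add: log_ratio_def algebra_simps)
        then have "ereal (kl \<rho> (m u) (m t)) \<le> ?F"
          by (intro SUP_upper2[of u]) (simp_all add: log_ratio_mean)
        from this a show "ereal (kl \<rho> (m u) (m t)) < a" by (rule le_less_trans)
      qed
    qed
    moreover have "at x within range m \<noteq> bot"
      using boundary by (auto simp: trivial_limit_within closure_def)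
    ultimately have "Lim (at x within range m) (\<lambda>y. ereal (kl \<rho> y (m t))) = ?F"
      by (intro tendsto_Lim)
    with boundary show ?thesis by (simp add: kl_ext_def mean_set_eq)
  qed
qed

text \<open>If the index is below \<open>m t\<close>, then \<open>m t\<close> violates the
  constraint, and the dual form yields a violating tilt. An x at or above \<open>m t\<close> would
  push the index up to \<open>m t\<close>; for x below \<open>m t\<close>, tilts s at or above t
  have nonpositive log-ratio, which leaves s < t.\<close>

lemma index_of_lessD:
  assumes c: "0 \<le> c" and U: "index_of \<rho> x c < ereal (m t)"
  obtains s where "s < t" "c < log_ratio t s x" "x < m t"
proof -
  let ?S = "{\<mu> \<in> mean_set \<rho>. kl_ext \<rho> x \<mu> \<le> ereal c}"
  have up: "m v < m t" if "m v \<in> ?S" for v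
  proof -
    have "ereal (m v) \<le> index_of \<rho> x c" using that
      by (auto simp: index_of_def Let_def intro!: SUP_upper)
    from le_less_trans[OF this U] show ?thesis by simp
  qed
  have mt: "m t \<notin> ?S" using up[of t] by blast
  then have "ereal c < kl_ext \<rho> x (m t)" by (auto simp: mean_set_eq)
  then obtain s where s: "c < log_ratio t s x" by (auto simp: kl_ext_eq_SUP less_SUP_iff)
  have x: "x < m t"
  proof (rule ccontr)
    assume "\<not> x < m t"
    then have x: "m t \<le> x" by simp
    show False
    proof (cases "x \<in> range m")
      case True
      then obtain v where v: "x = m v" by blast
      have "m v \<in> ?S" using c by (simp add: v mean_set_eq kl_ext_def kl_mean)
      from up[OF this] x v show False by simp
    next
      case False
      \<comment> \<open>Here x lies beyond the upper end of the mean set. The default index x would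
        not be below \<open>m t\<close>, so some mean below \<open>m t\<close> is feasible; the
        divergence from x decreases towards the upper end, which would make \<open>m t\<close>
        feasible as well.\<close>
      have above: "m s < x" for s
        using not_in_range_mean[OF False] x by (meson leD)
      have "?S \<noteq> {}"
      proof
        assume "?S = {}"
        then have "index_of \<rho> x c = ereal x" by (simp add: index_of_def)
        with U x show False by simp
      qed
      then obtain v where v: "m v \<in> ?S" by (auto simp: mean_set_eq)
      have vt: "v < t" using up[OF v] strict_mono_less[OF strict_mono_mean] by simp
      have "kl_ext \<rho> x (m t) \<le> kl_ext \<rho> x (m v)"
        unfolding kl_ext_eq_SUP
      proof (rule SUP_mono, intro bexI)
        fix r
        have "b t - b v \<le> m t * (t - v)" using tangent_le[of t v] by (simp add: algebra_simps)
        also have "\<dots> \<le> x * (t - v)" using above[of t] vt by (intro mult_right_mono) auto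
        finally show "ereal (log_ratio t r x) \<le> ereal (log_ratio v r x)"
          by (simp add: log_ratio_def algebra_simps)
      qed simp
      also have "\<dots> \<le> ereal c" using v by simp
      finally show False using mt by (simp add: mean_set_eq)
    qed
  qed
  have "s < t"
  proof (rule ccontr)
    assume "\<not> s < t"
    then have "(s - t) * x \<le> (s - t) * m t" using x by (intro mult_left_mono) auto
    also have "\<dots> \<le> b s - b t" using tangent_le[of t s] by (simp add: algebra_simps)
    finally have "log_ratio t s x \<le> 0" by (simp add: log_ratio_def)
    with s c show False by simp
  qed
  with s x that show ?thesis by blast
qed

lemma kl_mono_right:
  assumes "u \<le> r" "r \<le> v" shows "kl \<rho> (m u) (m r) \<le> kl \<rho> (m u) (m v)"
proof -
  have "m u * (v - r) \<le> m r * (v - r)"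
    using assms strict_mono_less_eq[OF strict_mono_mean] by (intro mult_right_mono) auto
  with tangent_le[of r v] show ?thesis by (simp add: kl_mean algebra_simps)
qed

text \<open>The supremum defining the index need not be attained at or above \<open>m t\<close>, so
  the bound is proved for every r in (u, t), beyond which a feasible mean exists, and then passed to
  the limit r to t. Replacing x by the larger \<open>m u\<close> only lowers the affine function
  with tilt u < v.\<close>

lemma index_of_geD:
  assumes U: "ereal (m t) \<le> index_of \<rho> x c" and x: "x \<le> m u" and ut: "u < t"
  shows "kl \<rho> (m u) (m t) \<le> c"
proof -
  let ?S = "{\<mu> \<in> mean_set \<rho>. kl_ext \<rho> x \<mu> \<le> ereal c}"
  have "m u < m t" using ut strict_mono_less[OF strict_mono_mean] by simp
  have S: "?S \<noteq> {}"
  proof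
    assume "?S = {}"
    then have "index_of \<rho> x c = ereal x" by (simp add: index_of_def)
    with U x \<open>m u < m t\<close> show False by simp
  qed
  have *: "kl \<rho> (m u) (m r) \<le> c" if r: "u < r" "r < t" for r
  proof -
    have "ereal (m r) < ereal (m t)" using r strict_mono_less[OF strict_mono_mean] by simp
    also have "\<dots> \<le> (SUP \<mu>\<in>?S. ereal \<mu>)" using U unfolding index_of_def Let_def if_not_P[OF S] .
    finally obtain \<mu> where "\<mu> \<in> ?S" "ereal (m r) < ereal \<mu>" unfolding less_SUP_iff by blast
    then obtain v where v: "m r < m v" "kl_ext \<rho> x (m v) \<le> ereal c"
      by (auto simp: mean_set_eq)
    have rv: "r < v" using v(1) strict_mono_less[OF strict_mono_mean] by simp
    have "kl \<rho> (m u) (m r) \<le> kl \<rho> (m u) (m v)" using r rv by (intro kl_mono_right) auto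
    also have "\<dots> = log_ratio v u (m u)" by (simp add: log_ratio_mean)
    also have "\<dots> \<le> log_ratio v u x"
      using x r rv by (simp add: log_ratio_def mult_left_mono_neg)
    also have "\<dots> \<le> c"
      using order_trans[OF SUP_upper[of u UNIV "\<lambda>s. ereal (log_ratio v s x)"] v(2)[unfolded kl_ext_eq_SUP]]
      by simp
    finally show ?thesis .
  qed
  have "continuous (at_left t) b"
    using DERIV_isCont[OF b_deriv] continuous_within_subset by blast
  then have "((\<lambda>r. kl \<rho> (m u) (m r)) \<longlongrightarrow> kl \<rho> (m u) (m t)) (at_left t)"
    unfolding kl_mean continuous_within by (intro tendsto_intros)
  moreover have "\<forall>\<^sub>F r in at_left t. kl \<rho> (m u) (m r) \<le> c"
    using eventually_at_left_real[OF ut] by eventually_elim (simp add: *)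
  ultimately show ?thesis by (rule tendsto_upperbound) simp
qed

end


section \<open>A maximal inequality for the bandit game\<close>

locale bandit_play =
  fixes K :: nat and \<nu> :: "nat \<Rightarrow> real measure" and T :: nat and M :: "'w measure"
    and F :: "nat \<Rightarrow> 'w measure" and A :: "nat \<Rightarrow> 'w \<Rightarrow> nat" and Y :: "nat \<Rightarrow> 'w \<Rightarrow> real"
  assumes game: "bandit_game K \<nu> T M F A Y"
    and law: "\<And>a. a \<in> {1..K} \<Longrightarrow> prob_space (\<nu> a)" "\<And>a. a \<in> {1..K} \<Longrightarrow> sets (\<nu> a) = sets borel"
begin

sublocale prob_space M
  using game by (simp add: bandit_game_def)

lemma subalg: "subalgebra M (F t)"
  and subalg_mono: "s \<le> t \<Longrightarrow> subalgebra (F t) (F s)"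
  and A_meas: "t \<in> {1..T} \<Longrightarrow> A t \<in> measurable (F (t - 1)) (count_space {1..K})"
  and Y_meas: "t \<in> {1..T} \<Longrightarrow> Y t \<in> borel_measurable (F t)"
  using game by (auto simp: bandit_game_def)

lemma cond_law:
  "t \<in> {1..T} \<Longrightarrow> S \<in> sets borel \<Longrightarrow>
     AE w in M. real_cond_exp M (F (t - 1)) (\<lambda>w. indicator S (Y t w)) w = measure (\<nu> (A t w)) S"
  using game by (auto simp: bandit_game_def)

lemma space_F [simp]: "space (F t) = space M"
  using subalg[of t] by (simp add: subalgebra_def)

lemma meas_mono: "s \<le> t \<Longrightarrow> f \<in> measurable (F s) N \<Longrightarrow> f \<in> measurable (F t) N"
  using measurable_from_subalg[OF subalg_mono] .

lemma sets_mono: "s \<le> t \<Longrightarrow> E \<in> sets (F s) \<Longrightarrow> E \<in> sets (F t)"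
  using subalg_mono[of s t] by (auto simp: subalgebra_def)

lemma sets_F_M: "E \<in> sets (F t) \<Longrightarrow> E \<in> sets M"
  using subalg[of t] by (auto simp: subalgebra_def)

lemma meas_M: "f \<in> measurable (F t) N \<Longrightarrow> f \<in> measurable M N"
  using measurable_from_subalg[OF subalg] .

lemma A_range: "t \<in> {1..T} \<Longrightarrow> w \<in> space M \<Longrightarrow> A t w \<in> {1..K}"
  using measurable_space[OF A_meas, of t w] by simp

lemma A_eq_sets:
  assumes t: "t \<in> {1..T}" shows "{w \<in> space M. A t w = a} \<in> sets (F (t - 1))"
proof -
  have "A t -` ({a} \<inter> {1..K}) \<inter> space (F (t - 1)) \<in> sets (F (t - 1))"
    by (rule measurable_sets[OF A_meas[OF t]]) simp
  also have "A t -` ({a} \<inter> {1..K}) \<inter> space (F (t - 1)) = {w \<in> space M. A t w = a}"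
    using A_range[OF t] by auto
  finally show ?thesis .
qed

text \<open>The conditional-law clause of the game as an identity of measures: on a past event
  within a pull of arm a, the reward is a fresh draw. Later arguments use this identity in place of
  conditional expectations.\<close>

lemma reward_law:
  assumes t: "t \<in> {1..T}" and B: "B \<in> sets (F (t - 1))" "B \<subseteq> {w. A t w = a}" and a: "a \<in> {1..K}"
  shows "distr (density M (indicator B)) borel (Y t) = density (\<nu> a) (\<lambda>_. emeasure M B)"
proof (rule measure_eqI)
  have [measurable]: "Y t \<in> borel_measurable M" using meas_M[OF Y_meas[OF t]] .
  have BM[measurable]: "B \<in> sets M" using sets_F_M[OF B(1)] .
  note [measurable_cong] = law(2)[OF a]
  interpret N: prob_space "\<nu> a" by (rule law(1)[OF a])
  interpret S: sigma_finite_subalgebra M "F (t - 1)"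
    using finite_measure_subalgebra_is_sigma_finite[of M "F (t - 1)"] subalg finite_measure_axioms
    by (simp add: finite_measure_subalgebra_def finite_measure_subalgebra_axioms_def)
  fix S assume "S \<in> sets (distr (density M (indicator B)) borel (Y t))"
  then have S[measurable]: "S \<in> sets borel" by simp
  let ?E = "B \<inter> (Y t -` S \<inter> space M)"
  have ind: "integrable M (\<lambda>w. indicator S (Y t w) :: real)"
    by (rule integrable_const_bound[of _ 1]) auto
  have "measure M ?E = (\<integral>w. indicator B w * indicator S (Y t w) \<partial>M)"
  proof -
    have "(\<integral>w. indicator B w * indicator S (Y t w) \<partial>M) = (\<integral>w. (indicator ?E w :: real) \<partial>M)"
      by (rule Bochner_Integration.integral_cong) (auto simp: indicator_def)
    also have "\<dots> = measure M ?E" by simp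
    finally show ?thesis by simp
  qed
  also have "\<dots> = (\<integral>w. indicator B w * real_cond_exp M (F (t - 1)) (\<lambda>w. indicator S (Y t w)) w \<partial>M)"
    using S.real_cond_exp_intA[OF ind B(1)] by (simp add: set_lebesgue_integral_def)
  also have "\<dots> = (\<integral>w. indicator B w * measure (\<nu> a) S \<partial>M)"
    using cond_law[OF t S] B(2)
    by (intro integral_cong_AE) (auto elim!: eventually_mono simp: indicator_def subset_iff)
  also have "\<dots> = measure M B * measure (\<nu> a) S" by simp
  finally have "measure M ?E = measure M B * measure (\<nu> a) S" .
  then have "emeasure M ?E = emeasure M B * emeasure (\<nu> a) S"
    by (simp add: emeasure_eq_measure N.emeasure_eq_measure ennreal_mult')
  then show "emeasure (distr (density M (indicator B)) borel (Y t)) S = emeasure (density (\<nu> a) (\<lambda>_. emeasure M B)) S"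
    by (simp add: emeasure_distr emeasure_density nn_integral_cmult law(2)[OF a]
        indicator_inter_arith[symmetric] nn_integral_indicator)
qed (simp add: law(2)[OF a])

text \<open>For an indicator Z this is \<open>reward_law\<close>; linearity and monotone limits
  extend it to all nonnegative functions of the past.\<close>

lemma reward_nn_integral:
  assumes t: "t \<in> {1..T}" and Z: "Z \<in> borel_measurable (F (t - 1))" and a: "a \<in> {1..K}"
    and f[measurable]: "f \<in> borel_measurable borel"
  shows "(\<integral>\<^sup>+w. Z w * indicator {w \<in> space M. A t w = a} w * f (Y t w) \<partial>M) =
    (\<integral>\<^sup>+w. Z w * indicator {w \<in> space M. A t w = a} w \<partial>M) * (\<integral>\<^sup>+x. f x \<partial>\<nu> a)"
proof -
  have [measurable]: "Y t \<in> borel_measurable M" using meas_M[OF Y_meas[OF t]] .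
  note [measurable_cong] = law(2)[OF a]
  let ?D = "{w \<in> space M. A t w = a}"
  note D = A_eq_sets[OF t, of a]
  have [measurable]: "?D \<in> sets M" using sets_F_M[OF D] .
  show ?thesis using Z
  proof (induction rule: borel_measurable_induct)
    case (cong f g) then show ?case by (simp cong: nn_integral_cong)
  next
    case (set B)
    have [measurable]: "B \<in> sets M" using sets_F_M[OF set] .
    have BD: "B \<inter> ?D \<in> sets (F (t - 1))" using set D by blast
    have "(\<integral>\<^sup>+w. indicator B w * indicator ?D w * f (Y t w) \<partial>M) = (\<integral>\<^sup>+w. f (Y t w) \<partial>density M (indicator (B \<inter> ?D)))"
      by (subst nn_integral_density) (auto simp: indicator_inter_arith)
    also have "\<dots> = (\<integral>\<^sup>+x. f x \<partial>distr (density M (indicator (B \<inter> ?D))) borel (Y t))"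
      by (subst nn_integral_distr) auto
    also have "\<dots> = emeasure M (B \<inter> ?D) * (\<integral>\<^sup>+x. f x \<partial>\<nu> a)"
      by (subst reward_law[OF t BD _ a]) (auto simp: nn_integral_density nn_integral_cmult)
    also have "emeasure M (B \<inter> ?D) = (\<integral>\<^sup>+w. indicator B w * indicator ?D w \<partial>M)"
      by (simp add: indicator_inter_arith[symmetric])
    finally show ?case .
  next
    case (mult u c)
    have [measurable]: "u \<in> borel_measurable M" using meas_M mult(2) by blast
    show ?case using mult by (simp add: nn_integral_cmult mult.assoc)
  next
    case (add u v)
    have [measurable]: "u \<in> borel_measurable M" "v \<in> borel_measurable M" using meas_M add by blast+
    show ?case using add by (simp add: nn_integral_add distrib_right)
  next
    case (seq U)
    have [measurable]: "U i \<in> borel_measurable M" for i using meas_M seq by blast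
    have 1: "(\<integral>\<^sup>+w. (SUP i. U i) w * indicator ?D w * f (Y t w) \<partial>M) =
        (SUP i. \<integral>\<^sup>+w. U i w * indicator ?D w * f (Y t w) \<partial>M)"
      using seq by (subst nn_integral_monotone_convergence_SUP[symmetric])
        (auto simp: SUP_mult_right_ennreal image_comp incseq_def le_fun_def intro!: mult_right_mono)
    have 2: "(\<integral>\<^sup>+w. (SUP i. U i) w * indicator ?D w \<partial>M) =
        (SUP i. \<integral>\<^sup>+w. U i w * indicator ?D w \<partial>M)"
      using seq by (subst nn_integral_monotone_convergence_SUP[symmetric])
        (auto simp: SUP_mult_right_ennreal image_comp incseq_def le_fun_def intro!: mult_right_mono)
    show ?case unfolding 1 2 using seq by (simp add: SUP_mult_right_ennreal)
  qed
qed

text \<open>Each factor has conditional mean one given the past, so every round preserves the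
  expectation. H is a switch decided before the round; it allows the product to be stopped at a
  random time.\<close>

lemma predictable_product:
  assumes a: "a \<in> {1..K}" and f: "f \<in> borel_measurable borel" "(\<integral>\<^sup>+x. f x \<partial>\<nu> a) = 1"
    and H: "\<And>s. s \<in> {1..T} \<Longrightarrow> {w \<in> space M. H s w} \<in> sets (F (s - 1))"
    and "t \<le> T"
  shows "(\<lambda>w. \<Prod>s=1..t. if A s w = a \<and> H s w then f (Y s w) else (1::ennreal)) \<in> borel_measurable (F t) \<and>
    (\<integral>\<^sup>+w. (\<Prod>s=1..t. if A s w = a \<and> H s w then f (Y s w) else (1::ennreal)) \<partial>M) = 1"
  using \<open>t \<le> T\<close>
proof (induction t)
  case 0
  then show ?case using emeasure_space_1 by simp
next
  case (Suc t)
  let ?V = "\<lambda>t w. \<Prod>s=1..t. if A s w = a \<and> H s w then f (Y s w) else (1::ennreal)"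
  note f(1)[measurable]
  have IH: "?V t \<in> borel_measurable (F t)" "(\<integral>\<^sup>+w. ?V t w \<partial>M) = 1" using Suc by auto
  have t: "Suc t \<in> {1..T}" using Suc by simp
  let ?D = "{w \<in> space M. A (Suc t) w = a}" and ?H = "{w \<in> space M. H (Suc t) w}"
  have DH: "?D \<in> sets (F t)" "?H \<in> sets (F t)" using A_eq_sets[OF t] H[OF t] by simp_all
  have [measurable]: "?D \<in> sets M" "?H \<in> sets M" using DH sets_F_M by blast+
  have [measurable]: "Y (Suc t) \<in> borel_measurable M" using meas_M[OF Y_meas[OF t]] .
  have [measurable]: "?V t \<in> borel_measurable M" using meas_M[OF IH(1)] .
  have meas: "?V (Suc t) \<in> borel_measurable (F (Suc t))"
  proof -
    have 1: "?V t \<in> borel_measurable (F (Suc t))" using IH(1) meas_mono[of t "Suc t"] by simp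
    have 2: "{w \<in> space (F (Suc t)). A (Suc t) w = a \<and> H (Suc t) w} \<in> sets (F (Suc t))"
    proof -
      have "{w \<in> space (F (Suc t)). A (Suc t) w = a \<and> H (Suc t) w} = ?D \<inter> ?H" by auto
      also have "\<dots> \<in> sets (F (Suc t))" using DH by (intro sets_mono[of t "Suc t"]) auto
      finally show ?thesis .
    qed
    have 3: "(\<lambda>w. f (Y (Suc t) w)) \<in> borel_measurable (F (Suc t))"
      using Y_meas[OF t] by measurable
    show ?thesis
      unfolding prod.cl_ivl_Suc using 1 2 3
      by (auto intro!: borel_measurable_times_ennreal measurable_If)
  qed
  have Z1: "(\<lambda>w. ?V t w * indicator ?H w) \<in> borel_measurable (F t)"
    using IH(1) DH by simp
  have "(\<integral>\<^sup>+w. ?V (Suc t) w \<partial>M) =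
      (\<integral>\<^sup>+w. ?V t w * indicator ?H w * indicator ?D w * f (Y (Suc t) w) + ?V t w * indicator (space M - ?H \<inter> ?D) w \<partial>M)"
    by (intro nn_integral_cong) (auto simp: indicator_def)
  also have "\<dots> = (\<integral>\<^sup>+w. ?V t w * indicator ?H w * indicator ?D w * f (Y (Suc t) w) \<partial>M)
      + (\<integral>\<^sup>+w. ?V t w * indicator (space M - ?H \<inter> ?D) w \<partial>M)"
    by (rule nn_integral_add) measurable
  also have "(\<integral>\<^sup>+w. ?V t w * indicator ?H w * indicator ?D w * f (Y (Suc t) w) \<partial>M)
      = (\<integral>\<^sup>+w. ?V t w * indicator ?H w * indicator ?D w \<partial>M)"
    using reward_nn_integral[OF t _ a f(1), of "\<lambda>w. ?V t w * indicator ?H w"] Z1 f(2) by simp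
  also have "\<dots> + (\<integral>\<^sup>+w. ?V t w * indicator (space M - ?H \<inter> ?D) w \<partial>M) =
     (\<integral>\<^sup>+w. ?V t w * indicator ?H w * indicator ?D w + ?V t w * indicator (space M - ?H \<inter> ?D) w \<partial>M)"
    by (rule nn_integral_add[symmetric]) measurable
  also have "\<dots> = (\<integral>\<^sup>+w. ?V t w \<partial>M)"
    by (intro nn_integral_cong) (auto simp: indicator_def)
  finally show ?case using meas IH(2) by simp
qed

text \<open>Ville's inequality: freezing the likelihood product at the first time \<open>E\<close> occurs keeps its
  expectation equal to one.\<close>

lemma maximal_inequality:
  assumes a: "a \<in> {1..K}" and f: "f \<in> borel_measurable borel" "(\<integral>\<^sup>+x. f x \<partial>\<nu> a) = 1"
    and E: "\<And>t. t \<le> T \<Longrightarrow> {w \<in> space M. E t w} \<in> sets (F t)"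
    and c: "0 < c"
    and W: "\<And>t w. t \<le> T \<Longrightarrow> w \<in> space M \<Longrightarrow> E t w \<Longrightarrow>
       ennreal c \<le> (\<Prod>s=1..t. if A s w = a then f (Y s w) else 1)"
  shows "{w \<in> space M. \<exists>t\<le>T. E t w} \<in> sets M" "measure M {w \<in> space M. \<exists>t\<le>T. E t w} \<le> 1 / c"
proof -
  let ?E = "{w \<in> space M. \<exists>t\<le>T. E t w}"
  have EM: "{w \<in> space M. E t w} \<in> sets M" if "t \<le> T" for t using sets_F_M E[OF that] by blast
  have eq: "?E = (\<Union>t\<in>{..T}. {w \<in> space M. E t w})" by auto
  show meas: "?E \<in> sets M" unfolding eq using EM by (intro sets.finite_UN) auto
  \<comment> \<open>Only times strictly below s are inspected, so the switch is known at time s - 1,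
    while the product still includes the factor of the first occurrence itself.\<close>
  define H where "H s w \<longleftrightarrow> \<not> (\<exists>t<s. E t w)" for s w
  have H: "{w \<in> space M. H s w} \<in> sets (F (s - 1))" if s: "s \<in> {1..T}" for s
  proof -
    have "{w \<in> space M. H s w} = space (F (s - 1)) - (\<Union>t\<in>{..s-1}. {w \<in> space M. E t w})"
      using s by (auto simp: H_def)
    also have "\<dots> \<in> sets (F (s - 1))"
      using s by (intro sets.compl_sets sets.finite_UN) (auto intro: sets_mono[OF _ E])
    finally show ?thesis .
  qed
  define L where "L w = (\<Prod>s=1..T. if A s w = a \<and> H s w then f (Y s w) else (1::ennreal))" for w
  have L: "L \<in> borel_measurable (F T)" "(\<integral>\<^sup>+w. L w \<partial>M) = 1"
    using predictable_product[OF a f H order_refl] by (simp_all add: L_def[abs_def])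
  note [measurable] = meas_M[OF L(1)]
  have sub: "?E \<subseteq> {w \<in> space M. 1 \<le> ennreal (1 / c) * L w}"
  proof
    fix w assume "w \<in> ?E"
    then have w: "w \<in> space M" "\<exists>t\<le>T. E t w" by auto
    define \<tau> where "\<tau> = (LEAST t. E t w)"
    have \<tau>: "E \<tau> w" "\<tau> \<le> T" "\<And>t. t < \<tau> \<Longrightarrow> \<not> E t w"
      using w unfolding \<tau>_def by (auto intro: LeastI Least_le[THEN order_trans] dest: not_less_Least)
    have Hs: "H s w \<longleftrightarrow> s \<le> \<tau>" for s
      unfolding H_def using \<tau>(1,3) by (metis less_le_trans not_le)
    have "L w = (\<Prod>s=1..\<tau>. if A s w = a then f (Y s w) else 1)"
      unfolding L_def using \<tau>(2) by (intro prod.mono_neutral_cong_right) (auto simp: Hs)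
    with W[OF \<tau>(2) w(1) \<tau>(1)] have "ennreal c \<le> L w" by simp
    then have "ennreal (1 / c) * ennreal c \<le> ennreal (1 / c) * L w" by (rule mult_left_mono) simp
    moreover have "ennreal (1 / c) * ennreal c = 1" using c by (simp add: ennreal_mult'[symmetric])
    ultimately show "w \<in> {w \<in> space M. 1 \<le> ennreal (1 / c) * L w}" using w by simp
  qed
  have "emeasure M ?E \<le> emeasure M {w \<in> space M. 1 \<le> ennreal (1 / c) * L w}"
    by (intro emeasure_mono sub) measurable
  also have "\<dots> \<le> ennreal (1 / c) * (\<integral>\<^sup>+w. L w * indicator (space M) w \<partial>M)"
    using nn_integral_Markov_inequality[of L "space M" M "ennreal (1 / c)"] by simp
  also have "(\<integral>\<^sup>+w. L w * indicator (space M) w \<partial>M) = (\<integral>\<^sup>+w. L w \<partial>M)"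
    by (intro nn_integral_cong) auto
  finally have "emeasure M ?E \<le> ennreal (1 / c)" using L(2) by simp
  then show "measure M ?E \<le> 1 / c" using c by (simp add: emeasure_eq_measure)
qed

end


section \<open>Deviations of empirical means\<close>

lemma pulls_eq_sum: "real (pulls A a t w) = (\<Sum>s=1..t. if A s w = a then 1 else 0)"
  by (simp add: pulls_def sum.inter_filter[symmetric])

lemma pulls_mult_emp_mean:
  "real (pulls A a t w) * emp_mean A Y a t w = (\<Sum>s=1..t. if A s w = a then Y s w else 0)"
proof (cases "pulls A a t w = 0")
  case True
  then have "{s \<in> {1..t}. A s w = a} = {}" by (simp add: pulls_def)
  then have "(\<Sum>s=1..t. if A s w = a then Y s w else 0) = 0" by (intro sum.neutral) auto
  with True show ?thesis by simp
qed (simp add: emp_mean_def)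

section \<open>Measurability of counts and means; decomposition of the regret\<close>

context bandit_play
begin

lemma A_eq_sets_le:
  assumes "s \<in> {1..t}" "t \<le> T" shows "{w \<in> space (F t). A s w = a} \<in> sets (F t)"
proof -
  have "{w \<in> space M. A s w = a} \<in> sets (F (s - 1))" using assms by (intro A_eq_sets) auto
  moreover have "s - 1 \<le> t" using assms by auto
  ultimately show ?thesis by (simp add: sets_mono)
qed

lemma pulls_meas: "t \<le> T \<Longrightarrow> (\<lambda>w. real (pulls A a t w)) \<in> borel_measurable (F t)"
  unfolding pulls_eq_sum
  by (intro borel_measurable_sum measurable_If A_eq_sets_le) auto

lemma emp_mean_meas: "t \<le> T \<Longrightarrow> emp_mean A Y a t \<in> borel_measurable (F t)"
  unfolding emp_mean_def[abs_def]
  by (intro borel_measurable_divide pulls_meas borel_measurable_sum measurable_If A_eq_sets_le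
      meas_mono[OF _ Y_meas]) auto

lemma pulls_le: "pulls A a t w \<le> t"
proof -
  have "card {s \<in> {1..t}. A s w = a} \<le> card {1..t}" by (rule card_mono) auto
  then show ?thesis by (simp add: pulls_def)
qed

lemma pulls_integrable: "t \<le> T \<Longrightarrow> integrable M (\<lambda>w. real (pulls A a t w))"
  using meas_M[OF pulls_meas] pulls_le by (intro integrable_const_bound[of _ "real t"]) auto

lemma expected_pulls_le: "(\<integral>w. real (pulls A a T w) \<partial>M) \<le> real T"
  using integral_mono[OF pulls_integrable[OF order_refl], of "\<lambda>_. real T" a] pulls_le
  by (simp add: prob_space)

text \<open>Integrability of a reward is derived from that of the arms: restricted to a pull of arm
  a it has the law of that arm, and the K restrictions add up to the reward.\<close>

lemma expected_reward:
  assumes t: "t \<in> {1..T}"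
    and int: "\<And>a. a \<in> {1..K} \<Longrightarrow> integrable (\<nu> a) (\<lambda>x. x)"
  shows "integrable M (Y t)"
    "(\<integral>w. Y t w \<partial>M) = (\<Sum>a=1..K. (\<integral>x. x \<partial>\<nu> a) * (\<integral>w. (if A t w = a then 1 else 0) \<partial>M))"
proof -
  have [measurable]: "Y t \<in> borel_measurable M" using meas_M[OF Y_meas[OF t]] .
  let ?D = "\<lambda>a. {w \<in> space M. A t w = a}"
  have D[measurable]: "?D a \<in> sets M" for a using sets_F_M[OF A_eq_sets[OF t]] .
  have arm: "integrable M (\<lambda>w. indicator (?D a) w * Y t w) \<and>
      (\<integral>w. indicator (?D a) w * Y t w \<partial>M) = measure M (?D a) * (\<integral>x. x \<partial>\<nu> a)"
    if a: "a \<in> {1..K}" for a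
  proof -
    note [measurable_cong] = law(2)[OF a]
    let ?N = "density M (\<lambda>w. ennreal (indicator (?D a) w))"
    have law: "distr ?N borel (Y t) = density (\<nu> a) (\<lambda>_. ennreal (measure M (?D a)))"
      unfolding ennreal_indicator emeasure_eq_measure[symmetric]
      by (rule reward_law[OF t A_eq_sets[OF t, of a] _ a]) auto
    have i1: "integrable (density (\<nu> a) (\<lambda>_. ennreal (measure M (?D a)))) (\<lambda>x. x)"
      by (subst integrable_density) (auto intro!: int[OF a])
    have i2: "integrable ?N (Y t)"
      using i1 unfolding law[symmetric] by (subst (asm) integrable_distr_eq) auto
    have "(\<integral>w. indicator (?D a) w * Y t w \<partial>M) = (\<integral>w. Y t w \<partial>?N)"
      by (subst integral_density) auto
    also have "\<dots> = (\<integral>x. x \<partial>distr ?N borel (Y t))"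
      by (subst integral_distr) auto
    also have "\<dots> = measure M (?D a) * (\<integral>x. x \<partial>\<nu> a)"
      unfolding law by (subst integral_density) auto
    finally show ?thesis using i2 by (subst (asm) integrable_density) auto
  qed
  have split: "Y t w = (\<Sum>a=1..K. indicator (?D a) w * Y t w)" if w: "w \<in> space M" for w
  proof -
    have "(\<Sum>a=1..K. indicator (?D a) w * Y t w) = (\<Sum>a\<in>{1..K}. if A t w = a then Y t w else 0)"
      using w by (intro sum.cong) (auto simp: indicator_def)
    also have "\<dots> = Y t w" using A_range[OF t w] by simp
    finally show ?thesis by simp
  qed
  have "integrable M (\<lambda>w. \<Sum>a=1..K. indicator (?D a) w * Y t w)"
    using arm by (intro Bochner_Integration.integrable_sum) blast
  then show "integrable M (Y t)"
    by (subst Bochner_Integration.integrable_cong[OF refl split]) auto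
  have "(\<integral>w. Y t w \<partial>M) = (\<integral>w. (\<Sum>a=1..K. indicator (?D a) w * Y t w) \<partial>M)"
    by (rule Bochner_Integration.integral_cong[OF refl split])
  also have "\<dots> = (\<Sum>a=1..K. (\<integral>w. indicator (?D a) w * Y t w \<partial>M))"
    using arm by (intro Bochner_Integration.integral_sum) blast
  also have "\<dots> = (\<Sum>a=1..K. (\<integral>x. x \<partial>\<nu> a) * (\<integral>w. (if A t w = a then 1 else 0) \<partial>M))"
  proof (rule sum.cong[OF refl])
    fix a assume a: "a \<in> {1..K}"
    have "(\<integral>w. (if A t w = a then 1 else 0) \<partial>M) = (\<integral>w. indicator (?D a) w \<partial>M :: real)"
      by (intro Bochner_Integration.integral_cong) (auto simp: indicator_def)
    also have "\<dots> = measure M (?D a)" by simp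
    finally show "(\<integral>w. indicator (?D a) w * Y t w \<partial>M) = (\<integral>x. x \<partial>\<nu> a) * (\<integral>w. (if A t w = a then 1 else 0) \<partial>M)"
      using arm[OF a] by simp
  qed
  finally show "(\<integral>w. Y t w \<partial>M) = (\<Sum>a=1..K. (\<integral>x. x \<partial>\<nu> a) * (\<integral>w. (if A t w = a then 1 else 0) \<partial>M))" .
qed

lemma expected_pulls:
  "(\<integral>w. real (pulls A a T w) \<partial>M) = (\<Sum>t=1..T. \<integral>w. (if A t w = a then 1 else 0) \<partial>M)"
  unfolding pulls_eq_sum
proof (rule Bochner_Integration.integral_sum)
  fix t assume t: "t \<in> {1..T}"
  have "(\<lambda>w. if A t w = a then 1 else 0 :: real) \<in> borel_measurable M"
    using sets_F_M[OF A_eq_sets[OF t, of a]] by (intro measurable_If) auto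
  then show "integrable M (\<lambda>w. if A t w = a then 1 else 0 :: real)"
    by (intro integrable_const_bound[of _ 1]) auto
qed

lemma regret_eq:
  assumes int: "\<And>a. a \<in> {1..K} \<Longrightarrow> integrable (\<nu> a) (\<lambda>x. x)"
    and mean: "\<And>a. a \<in> {1..K} \<Longrightarrow> (\<integral>x. x \<partial>\<nu> a) = \<mu> a"
  shows "regret K \<mu> T M Y = (\<Sum>a=1..K. (best_mean K \<mu> - \<mu> a) * (\<integral>w. real (pulls A a T w) \<partial>M))"
proof -
  let ?p = "\<lambda>t a. \<integral>w. (if A t w = a then 1 else 0 :: real) \<partial>M"
  have "(\<integral>w. (\<Sum>t=1..T. Y t w) \<partial>M) = (\<Sum>t=1..T. \<integral>w. Y t w \<partial>M)"
    using expected_reward(1)[OF _ int] by (intro Bochner_Integration.integral_sum) auto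
  also have "\<dots> = (\<Sum>t=1..T. \<Sum>a=1..K. \<mu> a * ?p t a)"
    using expected_reward(2)[OF _ int] mean by (intro sum.cong) auto
  also have "\<dots> = (\<Sum>a=1..K. \<mu> a * (\<integral>w. real (pulls A a T w) \<partial>M))"
    by (subst sum.swap) (simp add: expected_pulls sum_distrib_left)
  finally have 1: "(\<integral>w. (\<Sum>t=1..T. Y t w) \<partial>M) = (\<Sum>a=1..K. \<mu> a * (\<integral>w. real (pulls A a T w) \<partial>M))" .
  have "real T = (\<integral>w. real T \<partial>M)" by (simp add: prob_space)
  also have "\<dots> = (\<integral>w. (\<Sum>a=1..K. real (pulls A a T w)) \<partial>M)"
  proof (rule Bochner_Integration.integral_cong[OF refl])
    fix w assume w: "w \<in> space M"
    have "(\<Sum>a=1..K. real (pulls A a T w)) = (\<Sum>t=1..T. \<Sum>a=1..K. if A t w = a then 1 else 0)"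
      unfolding pulls_eq_sum by (rule sum.swap)
    also have "\<dots> = (\<Sum>t=1..T. 1)"
      using A_range[OF _ w] by (intro sum.cong) auto
    finally show "real T = (\<Sum>a=1..K. real (pulls A a T w))" by simp
  qed
  also have "\<dots> = (\<Sum>a=1..K. \<integral>w. real (pulls A a T w) \<partial>M)"
    by (intro Bochner_Integration.integral_sum pulls_integrable order_refl)
  finally have 2: "real T = (\<Sum>a=1..K. \<integral>w. real (pulls A a T w) \<partial>M)" .
  show ?thesis
    unfolding regret_def 1 by (subst 2) (simp add: left_diff_distrib sum_subtractf mult.commute flip: sum_distrib_left)
qed

end

section \<open>Likelihood-ratio bounds for the empirical mean of one arm\<close>

locale exp_bandit = bounded_exp_family \<rho> V + bandit_play K "\<lambda>a. exp_law \<rho> (\<theta> a)" T M F A Y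
  for \<rho> V K \<theta> T M F A Y
begin

text \<open>The weight turns \<open>exp_law \<rho> t\<close> into \<open>exp_law \<rho> s\<close>,
  which has mass one because every real s is a natural parameter.\<close>

lemma integral_likelihood_ratio:
  "(\<integral>\<^sup>+x. ennreal (exp (log_ratio t s x)) \<partial>exp_law \<rho> t) = 1"
proof -
  note [measurable_cong] = sets_base
  interpret S: prob_space "exp_law \<rho> s"
    by (rule prob_space_exp_law[OF fam]) (simp add: natural_params_UNIV)
  have [measurable]: "log_ratio t s \<in> borel_measurable borel"
    unfolding log_ratio_def[abs_def] by measurable
  have "(\<integral>\<^sup>+x. ennreal (exp (log_ratio t s x)) \<partial>exp_law \<rho> t) =
      (\<integral>\<^sup>+x. ennreal (exp (x * s - b s)) \<partial>\<rho>)"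
    unfolding exp_law_def
    by (subst nn_integral_density)
      (auto intro!: nn_integral_cong simp: ennreal_mult'[symmetric] exp_add[symmetric] log_ratio_def algebra_simps)
  also have "\<dots> = emeasure (exp_law \<rho> s) (space (exp_law \<rho> s))"
    unfolding exp_law_def by (subst emeasure_density) (auto intro!: nn_integral_cong)
  also have "\<dots> = 1" by (rule S.emeasure_space_1)
  finally show ?thesis .
qed

lemma log_likelihood_sum:
  "(\<Sum>r=1..t. if A r w = a then log_ratio u s (Y r w) else 0) =
     real (pulls A a t w) * log_ratio u s (emp_mean A Y a t w)"
proof -
  have "(\<Sum>r=1..t. if A r w = a then log_ratio u s (Y r w) else 0) =
     (\<Sum>r=1..t. (s - u) * (if A r w = a then Y r w else 0) - (b s - b u) * (if A r w = a then 1 else 0))"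
    by (intro sum.cong) (auto simp: log_ratio_def)
  also have "\<dots> = (s - u) * (real (pulls A a t w) * emp_mean A Y a t w) - (b s - b u) * real (pulls A a t w)"
    unfolding sum_subtractf sum_distrib_left[symmetric] pulls_mult_emp_mean unfolding pulls_eq_sum ..
  finally show ?thesis by (simp add: log_ratio_def algebra_simps)
qed

text \<open>On this event the likelihood product with tilt s reaches exp (k y) at some round, so the
  maximal inequality applies. As s may lie on either side of \<open>\<theta> a\<close>, both upper
  and lower deviations are covered.\<close>

lemma deviation:
  fixes k s y :: real
  assumes a: "a \<in> {1..K}" and y: "0 \<le> y"
  defines "E \<equiv> {w \<in> space M. \<exists>t\<le>T. k \<le> real (pulls A a t w) \<and> y \<le> log_ratio (\<theta> a) s (emp_mean A Y a t w)}"
  shows "E \<in> sets M" "measure M E \<le> exp (- (k * y))"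
proof -
  have lr[measurable]: "log_ratio (\<theta> a) s \<in> borel_measurable borel"
    unfolding log_ratio_def[abs_def] by measurable
  have f: "(\<lambda>x. ennreal (exp (log_ratio (\<theta> a) s x))) \<in> borel_measurable borel" by measurable
  have Et: "{w \<in> space M. k \<le> real (pulls A a t w) \<and> y \<le> log_ratio (\<theta> a) s (emp_mean A Y a t w)} \<in> sets (F t)"
    if t: "t \<le> T" for t
  proof -
    note [measurable] = pulls_meas[OF t, of a] emp_mean_meas[OF t, of a]
    have "{w \<in> space (F t). k \<le> real (pulls A a t w) \<and> y \<le> log_ratio (\<theta> a) s (emp_mean A Y a t w)} \<in> sets (F t)"
      by measurable
    then show ?thesis by simp
  qed
  have W: "ennreal (exp (k * y)) \<le> (\<Prod>r=1..t. if A r w = a then ennreal (exp (log_ratio (\<theta> a) s (Y r w))) else 1)"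
    if "k \<le> real (pulls A a t w) \<and> y \<le> log_ratio (\<theta> a) s (emp_mean A Y a t w)" for t w
  proof -
    have "k * y \<le> real (pulls A a t w) * y" using that y by (intro mult_right_mono) auto
    also have "\<dots> \<le> real (pulls A a t w) * log_ratio (\<theta> a) s (emp_mean A Y a t w)"
      using that by (intro mult_left_mono) auto
    also have "\<dots> = (\<Sum>r=1..t. if A r w = a then log_ratio (\<theta> a) s (Y r w) else 0)"
      by (rule log_likelihood_sum[symmetric])
    finally have "exp (k * y) \<le> exp (\<Sum>r=1..t. if A r w = a then log_ratio (\<theta> a) s (Y r w) else 0)" by simp
    also have "\<dots> = (\<Prod>r=1..t. exp (if A r w = a then log_ratio (\<theta> a) s (Y r w) else 0))"
      by (simp add: exp_sum)
    finally have "ennreal (exp (k * y)) \<le> (\<Prod>r=1..t. ennreal (exp (if A r w = a then log_ratio (\<theta> a) s (Y r w) else 0)))"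
      by (simp add: prod_ennreal ennreal_leI)
    also have "\<dots> = (\<Prod>r=1..t. if A r w = a then ennreal (exp (log_ratio (\<theta> a) s (Y r w))) else 1)"
      by (intro prod.cong) auto
    finally show ?thesis .
  qed
  note mi = maximal_inequality[OF a f integral_likelihood_ratio Et, where c = "exp (k * y)"]
  show "E \<in> sets M" unfolding E_def by (rule mi(1)) (use W in auto)
  have "measure M E \<le> 1 / exp (k * y)" unfolding E_def by (rule mi(2)) (use W in auto)
  then show "measure M E \<le> exp (- (k * y))" by (simp add: exp_minus inverse_eq_divide)
qed

text \<open>The tilts below \<open>\<theta> a\<close> cut out nested half-lines, so the supremum over them costs nothing.\<close>

lemma lower_deviation:
  fixes k y :: real
  assumes a: "a \<in> {1..K}" and y: "0 \<le> y"
  defines "E \<equiv> {w \<in> space M. \<exists>t\<le>T. k \<le> real (pulls A a t w) \<and>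
      (\<exists>s<\<theta> a. y < log_ratio (\<theta> a) s (emp_mean A Y a t w))}"
  shows "E \<in> sets M" "measure M E \<le> exp (- (k * y))"
proof -
  \<comment> \<open>The zero of the affine function \<open>log_ratio (\<theta> a) s - y\<close>; for
    s below \<open>\<theta> a\<close> its slope is negative, so the event for s is the half-line
    below this point.\<close>
  define e where "e s = (y + b s - b (\<theta> a)) / (s - \<theta> a)" for s
  have lr: "y < log_ratio (\<theta> a) s x \<longleftrightarrow> x < e s" "y \<le> log_ratio (\<theta> a) s x \<longleftrightarrow> x \<le> e s" if "s < \<theta> a" for s x
    using that by (auto simp: e_def log_ratio_def field_simps)
  have e_le: "e s \<le> m (\<theta> a)" if "s < \<theta> a" for s
  proof -
    have "log_ratio (\<theta> a) s (m (\<theta> a)) \<le> 0" using log_ratio_le_kl[of "\<theta> a" s "\<theta> a"] by (simp add: kl_mean)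
    then show ?thesis using lr(1)[OF that, of "m (\<theta> a)"] y by simp
  qed
  define z where "z = (SUP s\<in>{..<\<theta> a}. e s)"
  have bdd: "bdd_above (e ` {..<\<theta> a})" using e_le by (intro bdd_aboveI2[of _ _ "m (\<theta> a)"]) simp
  have z: "(\<exists>s<\<theta> a. x < e s) \<longleftrightarrow> x < z" for x
    unfolding z_def by (subst less_cSUP_iff[OF _ bdd]) auto
  \<comment> \<open>The supremum z need not be attained, so x < z is exhausted by closed half-lines,
    each of which lies within the event of a single tilt.\<close>
  define En where "En n = {w \<in> space M. \<exists>t\<le>T. k \<le> real (pulls A a t w) \<and>
      emp_mean A Y a t w \<le> z - 1 / real (Suc n)}" for n
  have EnM: "En n \<in> sets M" for n
  proof -
    have "{w \<in> space M. k \<le> real (pulls A a t w) \<and> emp_mean A Y a t w \<le> z - 1 / real (Suc n)} \<in> sets M"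
      if t: "t \<le> T" for t
    proof -
      note [measurable] = meas_M[OF pulls_meas[OF t, of a]] meas_M[OF emp_mean_meas[OF t, of a]]
      show ?thesis by measurable
    qed
    then have "(\<Union>t\<in>{..T}. {w \<in> space M. k \<le> real (pulls A a t w) \<and> emp_mean A Y a t w \<le> z - 1 / real (Suc n)}) \<in> sets M"
      by (intro sets.finite_UN) auto
    also have "(\<Union>t\<in>{..T}. {w \<in> space M. k \<le> real (pulls A a t w) \<and> emp_mean A Y a t w \<le> z - 1 / real (Suc n)}) = En n"
      by (auto simp: En_def)
    finally show ?thesis .
  qed
  have En_le: "measure M (En n) \<le> exp (- (k * y))" for n
  proof -
    obtain s where s: "s < \<theta> a" "z - 1 / real (Suc n) < e s" using z[of "z - 1 / real (Suc n)"] by auto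
    have "measure M (En n) \<le> measure M {w \<in> space M. \<exists>t\<le>T. k \<le> real (pulls A a t w) \<and>
        y \<le> log_ratio (\<theta> a) s (emp_mean A Y a t w)}"
      using s by (intro finite_measure_mono deviation[OF a y]) (auto simp: En_def lr(2))
    also have "\<dots> \<le> exp (- (k * y))" by (rule deviation[OF a y])
    finally show ?thesis .
  qed
  have inc: "incseq En"
  proof (rule incseq_SucI, rule subsetI)
    fix n w assume "w \<in> En n"
    moreover have "z - 1 / real (Suc n) \<le> z - 1 / real (Suc (Suc n))" by (simp add: frac_le)
    ultimately show "w \<in> En (Suc n)" unfolding En_def by (blast intro: order_trans)
  qed
  have E_eq: "E = (\<Union>n. En n)"
  proof (intro set_eqI iffI)
    fix w assume "w \<in> E"
    then obtain t where t: "w \<in> space M" "t \<le> T" "k \<le> real (pulls A a t w)" "emp_mean A Y a t w < z"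
      unfolding E_def using lr(1) z by blast
    then obtain n where "1 / real (Suc n) < z - emp_mean A Y a t w"
      using reals_Archimedean[of "z - emp_mean A Y a t w"] by (auto simp: inverse_eq_divide)
    with t have "w \<in> En n" unfolding En_def by (auto intro!: exI[of _ t])
    then show "w \<in> (\<Union>n. En n)" by blast
  next
    fix w assume "w \<in> (\<Union>n. En n)"
    then obtain n t where t: "w \<in> space M" "t \<le> T" "k \<le> real (pulls A a t w)"
      "emp_mean A Y a t w \<le> z - 1 / real (Suc n)" by (auto simp: En_def)
    have "emp_mean A Y a t w < z" using t(4) by (rule order.strict_trans1) simp
    then show "w \<in> E" using t unfolding E_def by (auto simp: lr(1) z[symmetric] intro!: exI[of _ t] dest: z[THEN iffD2])
  qed
  show "E \<in> sets M" unfolding E_eq using EnM by blast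
  have "(\<lambda>n. measure M (En n)) \<longlonglongrightarrow> measure M (\<Union>n. En n)"
    using EnM inc by (intro finite_Lim_measure_incseq) auto
  then show "measure M E \<le> exp (- (k * y))"
    unfolding E_eq by (rule LIMSEQ_le_const2) (use En_le in auto)
qed

end


section \<open>The index of an optimal arm\<close>

lemma log_plus_nonneg: "0 \<le> log_plus x"
  by (simp add: log_plus_def)

lemma explore_nonneg: "0 \<le> explore T K n"
  by (simp add: explore_def Let_def log_plus_nonneg)

lemma explore_eq:
  assumes "1 \<le> real T / (real K * real n)"
  shows "explore T K n = ln (real T / (real K * real n)) + ln (1 + (ln (real T / (real K * real n)))\<^sup>2)"
proof -
  let ?r = "real T / (real K * real n)"
  have l: "log_plus ?r = ln ?r" using assms by (simp add: log_plus_def)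
  have "0 < 1 + (ln ?r)\<^sup>2" by (simp add: add_pos_nonneg)
  then have "ln (?r * ((ln ?r)\<^sup>2 + 1)) = ln ?r + ln (1 + (ln ?r)\<^sup>2)"
    using assms by (subst ln_mult) (auto simp: add.commute)
  moreover have "0 \<le> ln ?r" using assms by simp
  moreover have "0 \<le> ln (1 + (ln ?r)\<^sup>2)" by simp
  ultimately show ?thesis unfolding explore_def Let_def l by (simp add: log_plus_def)
qed

text \<open>Keeps the exploration rate below twice its leading logarithm. The derivative is
  nonnegative since 1 + t + t^2/2 - 2 t = ((t - 1)^2 + 1) / 2.\<close>

lemma ln_one_plus_square_le:
  fixes x :: real assumes "0 \<le> x" shows "ln (1 + x\<^sup>2) \<le> x"
proof -
  have "1 + x\<^sup>2 \<le> exp x"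
  proof -
    have "0 \<le> exp x - x\<^sup>2 - 1"
    proof (rule nonneg_of_deriv_sign[where f = "\<lambda>x. exp x - x\<^sup>2 - 1" and f' = "\<lambda>x. exp x - 2 * x"
          and S = "{0..}" and c = 0])
      fix t :: real assume t: "t \<in> {0..}"
      show "((\<lambda>x. exp x - x\<^sup>2 - 1) has_real_derivative exp t - 2 * t) (at t)"
        by (auto intro!: derivative_eq_intros)
      have "1 + t + t\<^sup>2 / 2 \<le> exp t" using t by (intro exp_lower_Taylor_quadratic) simp
      moreover have "0 \<le> (t - 1)\<^sup>2" by simp
      ultimately have "0 \<le> exp t - 2 * t" by (simp add: power2_eq_square algebra_simps)
      then show "0 \<le> (exp t - 2 * t) * (t - 0)" using t by simp
    qed (use assms in \<open>auto simp: is_interval_ci\<close>)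
    then show ?thesis by simp
  qed
  then have "ln (1 + x\<^sup>2) \<le> ln (exp x)" by (intro ln_mono) (auto simp: add_pos_nonneg)
  then show ?thesis by simp
qed

text \<open>The subtracted end term makes the bound inductive: each increment is covered because exp
  1 is at least 2.\<close>

lemma exp_tail_sum_le:
  "(\<Sum>j\<in>{j0..<j0 + n}. exp (- real j)) \<le> 2 * (exp (- real j0) - exp (- real (j0 + n)))"
proof (induction n)
  case (Suc n)
  have "2 \<le> exp (1 :: real)" using exp_ge_add_one_self[of 1] by simp
  have "exp (- real (j0 + n)) = exp 1 * exp (- real (j0 + Suc n))"
    by (simp add: exp_add[symmetric])
  also have "\<dots> \<ge> 2 * exp (- real (j0 + Suc n))"
    using \<open>2 \<le> exp 1\<close> by (intro mult_right_mono) auto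
  finally show ?case using Suc by simp
qed simp

text \<open>The j blocks of level j, each carrying the weight 1 / (1 + j^2), leave a factor of at
  most 1 / j0 in front of a geometric tail. That factor later cancels a ln s.\<close>

lemma block_sum_le:
  assumes "1 \<le> j0"
  shows "(\<Sum>j\<in>{j0..<j0 + n}. \<Sum>i<j. exp 4 * (exp (- real j) / (1 + (real j)\<^sup>2)))
    \<le> 2 * exp 4 * exp (- real j0) / real j0"
proof -
  have "(\<Sum>j\<in>{j0..<j0 + n}. \<Sum>i<j. exp 4 * (exp (- real j) / (1 + (real j)\<^sup>2)))
      \<le> (\<Sum>j\<in>{j0..<j0 + n}. exp 4 / real j0 * exp (- real j))"
  proof (rule sum_mono)
    fix j assume j: "j \<in> {j0..<j0 + n}"
    have "real j * real j0 \<le> real j * real j" using j by (intro mult_left_mono) auto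
    then have "real j / (1 + (real j)\<^sup>2) \<le> 1 / real j0"
      using assms by (simp add: divide_simps power2_eq_square add_pos_nonneg)
    then have "(exp 4 * exp (- real j)) * (real j / (1 + (real j)\<^sup>2)) \<le> (exp 4 * exp (- real j)) * (1 / real j0)"
      by (rule mult_left_mono) simp
    then show "(\<Sum>i<j. exp 4 * (exp (- real j) / (1 + (real j)\<^sup>2))) \<le> exp 4 / real j0 * exp (- real j)"
      by (simp add: mult_ac)
  qed
  also have "\<dots> = exp 4 / real j0 * (\<Sum>j\<in>{j0..<j0 + n}. exp (- real j))"
    by (simp add: sum_distrib_left)
  also have "\<dots> \<le> exp 4 / real j0 * (2 * exp (- real j0))"
  proof (rule mult_left_mono)
    show "(\<Sum>j\<in>{j0..<j0 + n}. exp (- real j)) \<le> 2 * exp (- real j0)"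
      by (rule order_trans[OF exp_tail_sum_le]) simp
  qed simp
  finally show ?thesis by (simp add: mult_ac)
qed

context exp_bandit
begin

text \<open>Changing the reference from u to \<open>\<theta> a\<close> adds
  \<open>log_ratio (\<theta> a) u x\<close>, which decreases in x and equals the divergence at x =
  \<open>m u\<close>.\<close>

lemma log_ratio_shift:
  assumes "u < \<theta> a" "x \<le> m u"
  shows "log_ratio u s x + kl \<rho> (m u) (m (\<theta> a)) \<le> log_ratio (\<theta> a) s x"
proof -
  have "(\<theta> a - u) * x \<le> (\<theta> a - u) * m u" using assms by (intro mult_left_mono) auto
  then show ?thesis by (simp add: log_ratio_def kl_mean algebra_simps)
qed

text \<open>With R = T / K, the block holds the counts n with ln (R / n) in [v, v + 1/j]. It
  combines the smallest count of the block with the smallest threshold, the one at n = R exp (- v);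
  their product is the exploration level at v reduced by the factor exp (- 1/j).\<close>

lemma peeling_block:
  assumes a: "a \<in> {1..K}" and R: "0 < R" and j: "1 \<le> j" "i < j"
  defines "v \<equiv> real j + real i / real j"
  defines "E \<equiv> {w \<in> space M. \<exists>t\<le>T. R * exp (- v - 1 / real j) \<le> real (pulls A a t w) \<and>
      (\<exists>s<\<theta> a. (v + ln (1 + v\<^sup>2)) * exp v / R < log_ratio (\<theta> a) s (emp_mean A Y a t w))}"
  shows "E \<in> sets M" "measure M E \<le> exp 4 * (exp (- real j) / (1 + (real j)\<^sup>2))"
proof -
  let ?g = "v + ln (1 + v\<^sup>2)"
  have v: "real j \<le> v" "v \<le> real j + 1" using j by (auto simp: v_def field_simps)
  have ln0: "0 \<le> ln (1 + v\<^sup>2)" by simp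
  have g0: "0 \<le> ?g" using v ln0 j by linarith
  have "ln (1 + v\<^sup>2) \<le> v" using v j by (intro ln_one_plus_square_le) linarith
  \<comment> \<open>The exploration level is at most 2 v, hence at most 2 (j + 1) and so at most 4
    j. A relative loss of 1/j in the exponent therefore costs at most the factor exp 4.\<close>
  then have g4: "?g / real j \<le> 4" using v j by (simp add: divide_simps)
  have y: "0 \<le> ?g * exp v / R" using R g0 by simp
  show "E \<in> sets M" unfolding E_def by (rule lower_deviation[OF a y])
  have "measure M E \<le> exp (- (R * exp (- v - 1 / real j) * (?g * exp v / R)))"
    unfolding E_def by (rule lower_deviation[OF a y])
  also have "R * exp (- v - 1 / real j) * (?g * exp v / R) = exp (- (1 / real j)) * ?g"
  proof -
    have "exp (- v - 1 / real j) * exp v = exp (- (1 / real j))" by (simp add: exp_add[symmetric])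
    then show ?thesis using R by (simp add: field_simps)
  qed
  also have "exp (- (exp (- (1 / real j)) * ?g)) \<le> exp (4 - ?g)"
  proof -
    have "1 - 1 / real j \<le> exp (- (1 / real j))" using exp_ge_add_one_self[of "- (1 / real j)"] by simp
    then have "(1 - 1 / real j) * ?g \<le> exp (- (1 / real j)) * ?g" using g0 by (rule mult_right_mono)
    moreover have "(1 - 1 / real j) * ?g = ?g - ?g / real j" by (simp add: left_diff_distrib)
    ultimately show ?thesis using g4 by simp
  qed
  also have "exp (4 - ?g) = exp 4 * (exp (- v) / (1 + v\<^sup>2))"
  proof -
    have "exp (4 - ?g) = exp 4 * exp (- v) * exp (- ln (1 + v\<^sup>2))"
      by (simp add: exp_add[symmetric])
    also have "exp (- ln (1 + v\<^sup>2)) = inverse (1 + v\<^sup>2)"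
      by (simp add: exp_minus add_pos_nonneg)
    finally show ?thesis by (simp add: divide_inverse mult_ac)
  qed
  also have "\<dots> \<le> exp 4 * (exp (- real j) / (1 + (real j)\<^sup>2))"
    using v by (intro mult_left_mono frac_le add_left_mono power_mono) (auto simp: add_pos_nonneg)
  finally show "measure M E \<le> exp 4 * (exp (- real j) / (1 + (real j)\<^sup>2))" .
qed

text \<open>The pull counts below \<open>ln s / D\<close> are peeled at the levels
  \<open>ln (T / (K n)) = j + i / j\<close>: this grid is fine enough that a block costs only a constant factor,
  and the squared logarithm in the exploration rate pays for the \<open>j\<close> blocks of level \<open>j\<close>.\<close>

lemma optimal_arm_large:
  assumes a: "a \<in> {1..K}" and K: "1 \<le> K" and u: "u < \<theta> a" and D: "0 < D" "D \<le> kl \<rho> (m u) (m (\<theta> a))"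
    and s: "s = real T * D / real K" "exp 2 \<le> s"
  shows "\<exists>E\<in>sets M. measure M E \<le> (1 + 8 * exp 5) / s \<and>
    (\<forall>w\<in>space M - E. \<forall>t\<le>T. 1 \<le> pulls A a t w \<longrightarrow> ereal (m u) \<le> ucb_index \<rho> T K A Y a t w)"
proof -
  define R where "R = real T / real K"
  have s0: "0 < s" using s(2) by (rule order.strict_trans2[rotated]) simp
  have s1: "1 < s" using exp_ge_add_one_self[of 2] s(2) by linarith
  have ls: "2 \<le> ln s" using ln_mono[OF s(2)] by simp
  have T0: "0 < T" using s0 s(1) by (cases "T = 0") auto
  have R0: "0 < R" using T0 K by (simp add: R_def)
  have sR: "s = R * D" using s(1) by (simp add: R_def)
  have quot_pos: "0 < s / ln s" using s0 ls by (intro divide_pos_pos) linarith+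
  \<comment> \<open>The lowest level to be peeled: counts below ln s / D are those with R / n above
    s / ln s.\<close>
  define l where "l = ln (s / ln s)"
  have l_eq: "l = ln s - ln (ln s)" unfolding l_def using s0 ls by (subst ln_div) auto
  \<comment> \<open>This gives ln (ln s) at most ln s / 2, so the level l is at least half of ln
    s.\<close>
  have "ln (ln s / 2) \<le> ln s / 2 - 1" using ls by (intro ln_le_minus_one) auto
  moreover have "ln (ln s / 2) = ln (ln s) - ln 2" using ls by (subst ln_div) auto
  moreover have "ln 2 \<le> (1::real)" using ln_le_minus_one[of 2] by simp
  ultimately have l_ge: "ln s / 2 \<le> l" "1 \<le> l" unfolding l_eq using ls by linarith+
  define j0 where "j0 = nat \<lfloor>l\<rfloor>"
  have j0: "1 \<le> j0" "real j0 \<le> l" "l \<le> real j0 + 1"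
    using l_ge(2) unfolding j0_def by (auto simp: le_nat_iff le_floor_iff)
  \<comment> \<open>Since n is at least 1, no level exceeds ln R; finitely many blocks
    suffice.\<close>
  define n0 where "n0 = nat \<lceil>ln R\<rceil> + 1"
  \<comment> \<open>Counts of at least ln s / D are settled by the single tilt u, which gains D per
    pull and so costs 1 / s.\<close>
  define EI where "EI = {w \<in> space M. \<exists>t\<le>T. ln s / D \<le> real (pulls A a t w) \<and>
      D \<le> log_ratio (\<theta> a) u (emp_mean A Y a t w)}"
  define vv where "vv j i = real j + real i / real j" for j i :: nat
  define EB where "EB j i = {w \<in> space M. \<exists>t\<le>T. R * exp (- vv j i - 1 / real j) \<le> real (pulls A a t w) \<and>
      (\<exists>s<\<theta> a. (vv j i + ln (1 + (vv j i)\<^sup>2)) * exp (vv j i) / R < log_ratio (\<theta> a) s (emp_mean A Y a t w))}" for j i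
  have EI: "EI \<in> sets M" "measure M EI \<le> 1 / s"
  proof -
    show "EI \<in> sets M" unfolding EI_def using D by (intro deviation[OF a]) simp
    have "measure M EI \<le> exp (- (ln s / D * D))" unfolding EI_def using D by (intro deviation[OF a]) simp
    also have "\<dots> = 1 / s" using D s0 by (simp add: exp_minus inverse_eq_divide)
    finally show "measure M EI \<le> 1 / s" .
  qed
  have EB: "EB j i \<in> sets M" "measure M (EB j i) \<le> exp 4 * (exp (- real j) / (1 + (real j)\<^sup>2))"
    if "j \<in> {j0..<j0 + n0}" "i \<in> {..<j}" for j i
    unfolding EB_def vv_def using that j0 by (intro peeling_block[OF a R0]; simp)+
  define BB where "BB = (\<Union>j\<in>{j0..<j0 + n0}. \<Union>i\<in>{..<j}. EB j i)"
  have BB_sets: "BB \<in> sets M" unfolding BB_def using EB(1) by (intro sets.finite_UN) auto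
  have "measure M BB \<le> (\<Sum>j\<in>{j0..<j0 + n0}. measure M (\<Union>i\<in>{..<j}. EB j i))"
    unfolding BB_def using EB(1) by (intro measure_UNION_le sets.finite_UN) auto
  also have "\<dots> \<le> (\<Sum>j\<in>{j0..<j0 + n0}. \<Sum>i<j. measure M (EB j i))"
    using EB(1) by (intro sum_mono measure_UNION_le) auto
  also have "\<dots> \<le> (\<Sum>j\<in>{j0..<j0 + n0}. \<Sum>i<j. exp 4 * (exp (- real j) / (1 + (real j)\<^sup>2)))"
    using EB(2) by (intro sum_mono) auto
  also have "\<dots> \<le> 2 * exp 4 * exp (- real j0) / real j0" by (rule block_sum_le[OF j0(1)])
  also have "\<dots> \<le> 8 * exp 5 / s"
  proof -
    have "exp (- real j0) \<le> exp (1 - l)" using j0(3) by simp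
    also have "\<dots> = exp 1 * (ln s / s)"
    proof -
      have "exp l = s / ln s" unfolding l_def by (rule exp_ln[OF quot_pos])
      then show ?thesis by (simp add: exp_diff)
    qed
    finally have 1: "2 * exp 4 * exp (- real j0) \<le> 2 * exp 4 * (exp 1 * (ln s / s))"
      by (rule mult_left_mono) simp
    \<comment> \<open>The average of the bounds j0 >= 1 and j0 >= ln s / 2 - 1. Thus 1 / j0 cancels
      the ln s left by exp (- j0), and 8 exp 5 collects 2 exp 4 from the blocks, exp 1 from the
      floor and this 4.\<close>
    have 2: "ln s / 4 \<le> real j0" using l_ge j0(1,3) by linarith
    have "2 * exp 4 * exp (- real j0) / real j0 \<le> 2 * exp 4 * (exp 1 * (ln s / s)) / (ln s / 4)"
      using 1 2 ls s1 by (intro frac_le) auto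
    also have "\<dots> = 8 * (exp 4 * exp 1) / s" using s1 by (simp add: field_simps)
    also have "exp 4 * exp 1 = exp (5::real)" by (simp add: exp_add[symmetric])
    finally show ?thesis .
  qed
  finally have BB_le: "measure M BB \<le> 8 * exp 5 / s" .
  show ?thesis
  proof (intro bexI conjI ballI allI impI)
    show "EI \<union> BB \<in> sets M" using EI BB_sets by blast
    have "measure M (EI \<union> BB) \<le> measure M EI + measure M BB"
      using EI BB_sets by (intro measure_Un_le) auto
    with EI(2) BB_le show "measure M (EI \<union> BB) \<le> (1 + 8 * exp 5) / s"
      by (simp add: add_divide_distrib)
    fix w t assume w: "w \<in> space M - (EI \<union> BB)" and t: "t \<le> T" and n1: "1 \<le> pulls A a t w"
    define n where "n = pulls A a t w"
    define x where "x = emp_mean A Y a t w"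
    show "ereal (m u) \<le> ucb_index \<rho> T K A Y a t w"
    proof (rule ccontr)
      assume "\<not> ereal (m u) \<le> ucb_index \<rho> T K A Y a t w"
      then have idx: "index_of \<rho> x (explore T K n / real n) < ereal (m u)"
        by (simp add: ucb_index_eq n_def x_def)
      have "0 \<le> explore T K n / real n" by (simp add: explore_nonneg)
      from index_of_lessD[OF this idx]
      obtain s' where s': "s' < u" "explore T K n / real n < log_ratio u s' x" and x: "x < m u"
        by blast
      have kl0: "0 \<le> kl \<rho> (m u) (m (\<theta> a))" using D by simp
      show False
      proof (cases "ln s / D \<le> real n")
        case True
        \<comment> \<open>The shift is applied with the tilt u itself, whose log-ratio against u is
          zero.\<close>
        have "D \<le> log_ratio (\<theta> a) u x"
          using log_ratio_shift[OF u, of x u] x D by (simp add: log_ratio_def)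
        with True t w show False by (auto simp: EI_def n_def x_def)
      next
        case False
        have n: "1 \<le> real n" using n1 by (simp add: n_def)
        define v0 where "v0 = ln (R / real n)"
        have "s / ln s \<le> R / real n"
        proof -
          have "s * real n \<le> s * (ln s / D)" using False s0 by (intro mult_left_mono) auto
          also have "\<dots> = R * ln s" using D by (simp add: sR)
          finally show ?thesis using n ls by (simp add: divide_simps mult_ac)
        qed
        then have lv: "l \<le> v0" unfolding l_def v0_def using quot_pos by (rule ln_mono)
        have Rn: "R / real n = exp v0" using R0 n by (simp add: v0_def)
        have vR: "v0 \<le> ln R" unfolding v0_def using R0 n by (intro ln_mono) (auto simp: divide_simps)
        define j where "j = nat \<lfloor>v0\<rfloor>"
        have jv: "real j \<le> v0" "v0 < real j + 1" using lv l_ge unfolding j_def by linarith+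
        have jj: "j0 \<le> j" using lv unfolding j_def j0_def by (intro nat_mono floor_mono)
        have jn: "j < j0 + n0"
        proof -
          have "real j \<le> real_of_int \<lceil>ln R\<rceil>" using jv vR by linarith
          then show ?thesis unfolding n0_def by linarith
        qed
        have j1: "1 \<le> j" using jj j0 by simp
        define i where "i = nat \<lfloor>(v0 - real j) * real j\<rfloor>"
        have i0: "0 \<le> (v0 - real j) * real j" using jv by simp
        have iv: "real i \<le> (v0 - real j) * real j" "(v0 - real j) * real j < real i + 1"
          using i0 unfolding i_def by linarith+
        have "(v0 - real j) * real j < 1 * real j" using jv j1 by (intro mult_strict_right_mono) auto
        with iv have ij: "i < j" by linarith
        have vle: "vv j i \<le> v0" "v0 \<le> vv j i + 1 / real j"
          using iv j1 by (auto simp: vv_def field_simps)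
        have vv1: "1 \<le> vv j i" using j1 by (simp add: vv_def add_increasing2)
        have c1: "R * exp (- vv j i - 1 / real j) \<le> real n"
        proof -
          have "R * exp (- vv j i - 1 / real j) \<le> R * exp (- v0)" using vle R0 by simp
          also have "\<dots> = real n" using Rn R0 n by (simp add: exp_minus field_simps)
          finally show ?thesis .
        qed
        have r1: "real T / (real K * real n) = exp v0" using Rn by (simp add: R_def)
        have ex: "explore T K n = v0 + ln (1 + v0\<^sup>2)"
          using lv l_ge by (subst explore_eq) (simp_all add: r1)
        have "(vv j i + ln (1 + (vv j i)\<^sup>2)) * exp (vv j i) / R \<le> (v0 + ln (1 + v0\<^sup>2)) * exp v0 / R"
          using vle vv1 R0
          by (intro divide_right_mono mult_mono add_mono ln_mono add_left_mono power_mono)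
            (auto simp: add_pos_nonneg intro!: add_nonneg_nonneg)
        also have "\<dots> = explore T K n / real n" unfolding ex Rn[symmetric] using R0 by simp
        also have "\<dots> < log_ratio u s' x" by (rule s')
        also have "\<dots> \<le> log_ratio (\<theta> a) s' x" using log_ratio_shift[OF u, of x s'] x kl0 by simp
        finally have "(vv j i + ln (1 + (vv j i)\<^sup>2)) * exp (vv j i) / R < log_ratio (\<theta> a) s' x" .
        with c1 t w s' u have "w \<in> EB j i" by (auto simp: EB_def n_def x_def intro!: exI[of _ t] exI[of _ s'])
        with jj jn ij w show False by (auto simp: BB_def)
      qed
    qed
  qed
qed

text \<open>The bound is multiplied by T because failure of the index may waste the whole
  horizon.\<close>

lemma optimal_arm:
  assumes a: "a \<in> {1..K}" and T: "1 \<le> T" and u: "u < \<theta> a" and D: "0 < D" "D \<le> kl \<rho> (m u) (m (\<theta> a))"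
  shows "\<exists>E\<in>sets M. real T * measure M E \<le> (1 + 8 * exp 5) * real K / D \<and>
    (\<forall>w\<in>space M - E. \<forall>t\<le>T. 1 \<le> pulls A a t w \<longrightarrow> ereal (m u) \<le> ucb_index \<rho> T K A Y a t w)"
proof -
  have K: "1 \<le> K" using a by simp
  define s where "s = real T * D / real K"
  have s0: "0 < s" using T K D by (simp add: s_def)
  have sT: "real T * (c / s) = c * real K / D" for c using T K D by (simp add: s_def field_simps)
  show ?thesis
  proof (cases "exp 2 \<le> s")
    case True
    obtain E where E: "E \<in> sets M" "measure M E \<le> (1 + 8 * exp 5) / s"
      "\<forall>w\<in>space M - E. \<forall>t\<le>T. 1 \<le> pulls A a t w \<longrightarrow> ereal (m u) \<le> ucb_index \<rho> T K A Y a t w"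
      using optimal_arm_large[OF a K u D s_def True] by blast
    have "real T * measure M E \<le> real T * ((1 + 8 * exp 5) / s)" using E(2) by (intro mult_left_mono) auto
    then show ?thesis using E unfolding sT by blast
  next
    case False
    \<comment> \<open>For s below exp 2 the claimed probability bound exceeds one, and the
      exceptional event may be the whole space.\<close>
    have "exp 2 \<le> 1 + 8 * exp (5::real)"
    proof -
      have "exp 2 \<le> exp (5::real)" by simp
      then show ?thesis using exp_gt_zero[of "5::real"] by linarith
    qed
    then have "1 \<le> (1 + 8 * exp 5) / s" using False s0 by simp
    then have "real T * measure M (space M) \<le> real T * ((1 + 8 * exp 5) / s)"
      by (intro mult_left_mono) (auto simp: prob_space)
    then show ?thesis unfolding sT by (intro bexI[of _ "space M"]) auto
  qed
qed

end


section \<open>Pulls of a suboptimal arm\<close>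

lemma pulls_Suc: "pulls A a (Suc t) w = pulls A a t w + (if A (Suc t) w = a then 1 else 0)"
proof -
  have "{s \<in> {1..Suc t}. A s w = a} =
      (if A (Suc t) w = a then insert (Suc t) {s \<in> {1..t}. A s w = a} else {s \<in> {1..t}. A s w = a})"
    by (auto simp: le_Suc_eq)
  then show ?thesis by (simp add: pulls_def)
qed

lemma pulls_mono: "s \<le> t \<Longrightarrow> pulls A a s w \<le> pulls A a t w"
  unfolding pulls_def by (intro card_mono) auto

lemma pulls_strict_mono:
  assumes "s < t" "A (Suc s) w = a" shows "pulls A a s w < pulls A a t w"
proof -
  have "pulls A a s w < pulls A a (Suc s) w" using assms(2) by (simp add: pulls_Suc)
  also have "\<dots> \<le> pulls A a t w" using assms(1) by (intro pulls_mono) simp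
  finally show ?thesis .
qed

lemma pulls_split:
  assumes "s \<le> t"
  shows "pulls A a t w = pulls A a s w + card {r \<in> {s..<t}. A (Suc r) w = a}"
  using assms
proof (induction t rule: dec_induct)
  case (step t)
  have "{r \<in> {s..<Suc t}. A (Suc r) w = a} =
      (if A (Suc t) w = a then insert t {r \<in> {s..<t}. A (Suc r) w = a} else {r \<in> {s..<t}. A (Suc r) w = a})"
    using step by (auto simp: less_Suc_eq)
  with step show ?case by (simp add: pulls_Suc)
qed simp

text \<open>The induction keeps the omitted tail exp (- N D); each step is exp D >= 1 + D.\<close>

lemma exp_sum_le_inverse:
  fixes D :: real assumes "0 < D"
  shows "(\<Sum>n=1..N. exp (- (real n * D))) \<le> 1 / D"
proof -
  have "D * (\<Sum>n=1..N. exp (- (real n * D))) \<le> 1 - exp (- (real N * D))"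
  proof (induction N)
    case (Suc N)
    have "exp (- (real N * D)) = exp D * exp (- (real (Suc N) * D))"
      by (simp add: exp_add[symmetric] algebra_simps)
    also have "\<dots> \<ge> (1 + D) * exp (- (real (Suc N) * D))"
      using exp_ge_add_one_self[of D] by (intro mult_right_mono) auto
    finally show ?case using Suc by (simp add: algebra_simps)
  qed simp
  also have "\<dots> \<le> 1" by simp
  finally show ?thesis using assms by (simp add: field_simps)
qed

lemma explore_le:
  assumes "1 \<le> K" "1 \<le> n" "1 \<le> T"
  shows "explore T K n \<le> ln (real T) + ln (1 + (ln (real T))\<^sup>2)"
proof -
  let ?r = "real T / (real K * real n)"
  have "1 * 1 \<le> real K * real n" using assms by (intro mult_mono) auto
  then have r: "0 < ?r" "?r \<le> real T" using assms by (auto simp: divide_simps)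
  have lT: "0 \<le> ln (real T)" using assms by simp
  show ?thesis
  proof (cases "1 \<le> ?r")
    case True
    have "ln ?r \<le> ln (real T)" "0 \<le> ln ?r" using r True by (auto intro: ln_mono)
    moreover from this have "(ln ?r)\<^sup>2 \<le> (ln (real T))\<^sup>2" by (intro power_mono)
    then have "ln (1 + (ln ?r)\<^sup>2) \<le> ln (1 + (ln (real T))\<^sup>2)"
      by (intro ln_mono) (auto simp: add_pos_nonneg)
    ultimately show ?thesis unfolding explore_eq[OF True] by linarith
  next
    case False
    then have "log_plus ?r = 0" using r by (simp add: log_plus_def)
    then have "explore T K n = 0" using False r by (simp add: explore_def Let_def)
    then show ?thesis using lT by simp
  qed
qed

context exp_bandit
begin

lemma pulls_init:
  assumes inj: "inj_on (\<lambda>t. A t w) {1..K}" and KT: "K \<le> T" and a: "a \<in> {1..K}" and w: "w \<in> space M"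
  shows "pulls A a K w = 1"
proof -
  have "(\<lambda>t. A t w) ` {1..K} = {1..K}"
    using A_range[OF _ w] KT by (intro endo_inj_surj[OF _ _ inj]) auto
  then obtain s where s: "s \<in> {1..K}" "A s w = a" using a by (metis imageE)
  have "{r \<in> {1..K}. A r w = a} = {s}"
  proof (intro set_eqI iffI)
    fix r assume "r \<in> {r \<in> {1..K}. A r w = a}"
    then show "r \<in> {s}" using inj_onD[OF inj, of r s] s by simp
  qed (use s in simp)
  then show ?thesis by (simp add: pulls_def)
qed

text \<open>Pulls after initialisation are counted by the pull count just before them, so a bound on
  the set of admissible counts bounds their number.\<close>

lemma expected_pulls_le_kl:
  assumes ucb: "kl_ucb_pp \<rho> K \<theta> T M F A Y" and KT: "K \<le> T"
    and a: "a \<in> {1..K}" and opt: "opt \<in> {1..K}"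
    and order: "\<theta> a < v" "v < u" "u < \<theta> opt"
    and D: "0 < D" "D \<le> kl \<rho> (m u) (m (\<theta> opt))" "D \<le> kl \<rho> (m v) (m (\<theta> a))"
  shows "(\<integral>w. real (pulls A a T w) \<partial>M) \<le>
     1 + (ln (real T) + ln (1 + (ln (real T))\<^sup>2)) / kl \<rho> (m v) (m u) + (2 + 8 * exp 5) * real K / D"
proof -
  have K: "1 \<le> K" using a by simp
  have T: "1 \<le> T" using K KT by simp
  let ?k = "kl \<rho> (m v) (m u)"
  define G where "G = ln (real T) + ln (1 + (ln (real T))\<^sup>2)"
  have G0: "0 \<le> G" unfolding G_def using T by (intro add_nonneg_nonneg) auto
  have mvu: "m v < m u" using order strict_mono_less[OF strict_mono_mean] by simp
  have k: "0 < ?k"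
    using kl_ge_square[of "m v" "m u"] mvu V_pos by (force simp: mean_set_eq intro: less_le_trans[rotated])
  obtain E where E: "E \<in> sets M" "real T * measure M E \<le> (1 + 8 * exp 5) * real K / D"
    "\<And>w t. w \<in> space M - E \<Longrightarrow> t \<le> T \<Longrightarrow> 1 \<le> pulls A opt t w \<Longrightarrow> ereal (m u) \<le> ucb_index \<rho> T K A Y opt t w"
    using optimal_arm[OF opt T order(3) D(1,2)] by blast
  \<comment> \<open>One event for each value of the pull count, not for each round, so that the
    probabilities form a geometric series with sum at most 1 / D.\<close>
  define B where "B n = {w \<in> space M. \<exists>t\<le>T. real n \<le> real (pulls A a t w) \<and>
      D \<le> log_ratio (\<theta> a) v (emp_mean A Y a t w)}" for n :: nat
  have B: "B n \<in> sets M" "measure M (B n) \<le> exp (- (real n * D))" for n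
    unfolding B_def using D by (intro deviation[OF a]; simp)+
  have pw: "real (pulls A a T w) \<le> 1 + G / ?k + (\<Sum>n=1..T. indicator (B n) w) + real T * indicator E w"
    if w: "w \<in> space M" for w
  proof (cases "w \<in> E")
    case True
    have "0 \<le> (\<Sum>n=1..T. indicator (B n) w :: real)" by (intro sum_nonneg) simp
    moreover have "0 \<le> G / ?k" using G0 k by simp
    moreover have "real (pulls A a T w) \<le> real T" using pulls_le by simp
    ultimately show ?thesis using True by simp
  next
    case False
    have inj: "inj_on (\<lambda>t. A t w) {1..K}"
      using ucb w KT by (simp add: kl_ucb_pp_def min_absorb1)
    have first: "pulls A c K w = 1" if "c \<in> {1..K}" for c by (rule pulls_init[OF inj KT that w])
    have ge1: "1 \<le> pulls A c t w" if "c \<in> {1..K}" "K \<le> t" for c t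
      using first[OF that(1)] pulls_mono[OF that(2), of A c w] by simp
    \<comment> \<open>Here r is the time at which the indices are computed, and the pull itself is
      round r + 1. Later elements see strictly larger counts.\<close>
    let ?Q = "{r \<in> {K..<T}. A (Suc r) w = a}"
    have inj2: "inj_on (\<lambda>r. pulls A a r w) ?Q"
      by (rule linorder_inj_onI') (auto dest: pulls_strict_mono[of _ _ A w a])
    have sub: "(\<lambda>r. pulls A a r w) ` ?Q \<subseteq> {1..nat \<lfloor>G / ?k\<rfloor>} \<union> {n \<in> {1..T}. w \<in> B n}"
    proof (rule image_subsetI)
      fix t assume t: "t \<in> ?Q"
      let ?n = "pulls A a t w" and ?x = "emp_mean A Y a t w"
      have n: "1 \<le> ?n" "?n \<le> T" using ge1[OF a, of t] t pulls_le[of a t w] by auto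
      show "?n \<in> {1..nat \<lfloor>G / ?k\<rfloor>} \<union> {n \<in> {1..T}. w \<in> B n}"
      proof (cases "?x \<le> m v")
        case True
        have "ereal (m u) \<le> ucb_index \<rho> T K A Y opt t w"
          using E(3)[of w t] ge1[OF opt, of t] False w t by simp
        also have "\<dots> \<le> ucb_index \<rho> T K A Y a t w"
          using ucb w opt t by (auto simp: kl_ucb_pp_def)
        finally have "ereal (m u) \<le> index_of \<rho> ?x (explore T K ?n / real ?n)" by (simp add: ucb_index_eq)
        from index_of_geD[OF this True order(2)] have "?k \<le> explore T K ?n / real ?n" .
        also have "\<dots> \<le> G / real ?n" unfolding G_def using explore_le[OF K n(1) T] by (simp add: divide_right_mono)
        finally have "real ?n \<le> G / ?k" using n k by (simp add: field_simps)
        then have "?n \<le> nat \<lfloor>G / ?k\<rfloor>" by (simp add: le_nat_floor)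
        then show ?thesis using n by simp
      next
        case False
        have "log_ratio (\<theta> a) v (m v) \<le> log_ratio (\<theta> a) v ?x"
          using False order by (simp add: log_ratio_def)
        then have "D \<le> log_ratio (\<theta> a) v ?x" using D(3) by (simp add: log_ratio_mean)
        then have "w \<in> B ?n" using w t by (auto simp: B_def intro!: exI[of _ t])
        then show ?thesis using n by simp
      qed
    qed
    have "card ?Q = card ((\<lambda>r. pulls A a r w) ` ?Q)" by (rule card_image[OF inj2, symmetric])
    also have "\<dots> \<le> card ({1..nat \<lfloor>G / ?k\<rfloor>} \<union> {n \<in> {1..T}. w \<in> B n})" by (rule card_mono[OF _ sub]) auto
    also have "\<dots> \<le> nat \<lfloor>G / ?k\<rfloor> + card {n \<in> {1..T}. w \<in> B n}"
      by (rule order_trans[OF card_Un_le]) simp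
    finally have "real (card ?Q) \<le> real (nat \<lfloor>G / ?k\<rfloor>) + real (card {n \<in> {1..T}. w \<in> B n})" by linarith
    also have "real (nat \<lfloor>G / ?k\<rfloor>) \<le> G / ?k" using G0 k by (intro of_nat_floor) simp
    also have "real (card {n \<in> {1..T}. w \<in> B n}) = (\<Sum>n=1..T. indicator (B n) w)"
      by (simp add: indicator_def sum.inter_filter[symmetric] Int_def)
    finally show ?thesis using False first[OF a] pulls_split[OF KT, of A a w] by simp
  qed
  have iB: "integrable M (\<lambda>w. indicator (B n) w :: real)" for n
    using B(1) by (intro integrable_const_bound[of _ 1]) auto
  have iE: "integrable M (\<lambda>w. indicator E w :: real)"
    using E(1) by (intro integrable_const_bound[of _ 1]) auto
  have "(\<integral>w. real (pulls A a T w) \<partial>M) \<le>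
      (\<integral>w. 1 + G / ?k + (\<Sum>n=1..T. indicator (B n) w) + real T * indicator E w \<partial>M)"
    using iB iE pw by (intro integral_mono pulls_integrable) auto
  also have "\<dots> = 1 + G / ?k + (\<Sum>n=1..T. measure M (B n)) + real T * measure M E"
  proof -
    have "(\<integral>w. 1 + G / ?k + (\<Sum>n=1..T. indicator (B n) w) + real T * indicator E w \<partial>M) =
       (\<integral>w. 1 + G / ?k + (\<Sum>n=1..T. indicator (B n) w) \<partial>M) + (\<integral>w. real T * indicator E w \<partial>M)"
      using iB iE by (intro Bochner_Integration.integral_add) auto
    also have "(\<integral>w. 1 + G / ?k + (\<Sum>n=1..T. indicator (B n) w) \<partial>M) =
       (\<integral>w. 1 + G / ?k \<partial>M) + (\<integral>w. (\<Sum>n=1..T. indicator (B n) w) \<partial>M)"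
      using iB by (intro Bochner_Integration.integral_add) auto
    also have "(\<integral>w. (\<Sum>n=1..T. indicator (B n) w) \<partial>M) = (\<Sum>n=1..T. (\<integral>w. (indicator (B n) w :: real) \<partial>M))"
      using iB by (intro Bochner_Integration.integral_sum) auto
    finally show ?thesis using B(1) E(1) by (simp add: prob_space)
  qed
  also have "(\<Sum>n=1..T. measure M (B n)) \<le> (\<Sum>n=1..T. exp (- (real n * D)))"
    by (intro sum_mono B(2))
  also have "\<dots> \<le> 1 / D" by (rule exp_sum_le_inverse[OF D(1)])
  \<comment> \<open>Merged with the K / D of the optimal arm, whence the constant 2 + 8 exp
    5.\<close>
  also have "1 / D \<le> real K / D" using K D by (simp add: divide_right_mono)
  also have "real T * measure M E \<le> (1 + 8 * exp 5) * real K / D" by (rule E(2))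
  finally have "(\<integral>w. real (pulls A a T w) \<partial>M) \<le> 1 + G / ?k + real K / D + (1 + 8 * exp 5) * real K / D"
    by simp
  also have "\<dots> = 1 + G / ?k + (2 + 8 * exp 5) * real K / D"
    by (simp add: add_divide_distrib algebra_simps)
  finally show ?thesis unfolding G_def .
qed

end


section \<open>From divergences to the gap \<delta> and to the asymptotic form\<close>

context bounded_exp_family
begin

lemma exp_banditI:
  assumes "kl_ucb_pp \<rho> K \<theta> T M F A Y" shows "exp_bandit \<rho> V K \<theta> T M F A Y"
proof (intro exp_bandit.intro bounded_exp_family_axioms bandit_play.intro)
  show "bandit_game K (\<lambda>a. exp_law \<rho> (\<theta> a)) T M F A Y" using assms by (simp add: kl_ucb_pp_def)
  show "prob_space (exp_law \<rho> (\<theta> a))" for a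
    by (rule prob_space_exp_law[OF fam]) (simp add: natural_params_UNIV)
  show "sets (exp_law \<rho> (\<theta> a)) = sets borel" for a
    by (simp add: exp_law_def sets_base)
qed

lemma range_mean_between: "m s \<le> x \<Longrightarrow> x \<le> m t \<Longrightarrow> x \<in> range m"
  using not_in_range_mean[of x] by (meson not_less)

lemma param_of_mean_isCont: "isCont (param_of_mean \<rho>) (m s)"
  by (rule isCont_inverse_function[where d = 1 and f = m and x = s])
    (simp_all add: DERIV_isCont[OF m_deriv])

lemma kl_tendsto:
  assumes "(f \<longlongrightarrow> m s) G" "(g \<longlongrightarrow> m t) G"
  shows "((\<lambda>x. kl \<rho> (f x) (g x)) \<longlongrightarrow> kl \<rho> (m s) (m t)) G"
proof -
  have p: "((\<lambda>x. param_of_mean \<rho> (f x)) \<longlongrightarrow> s) G" "((\<lambda>x. param_of_mean \<rho> (g x)) \<longlongrightarrow> t) G"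
    using isCont_tendsto_compose[OF param_of_mean_isCont assms(1)]
      isCont_tendsto_compose[OF param_of_mean_isCont assms(2)] by simp_all
  show ?thesis
    unfolding kl_def Let_def param_of_mean_mean
    by (intro tendsto_intros p isCont_tendsto_compose[OF DERIV_isCont[OF b_deriv]]
        isCont_tendsto_compose[OF DERIV_isCont[OF m_deriv]])
qed

lemma kl_pos: "m s < m t \<Longrightarrow> 0 < kl \<rho> (m s) (m t)"
  using kl_ge_square[of "m s" "m t"] V_pos
  by (force simp: mean_set_eq intro: less_le_trans[rotated])

text \<open>A gap of at least 3 \<delta> keeps the mean of a, its shift by \<delta>, the shifted
  optimal mean and the optimal mean at successive distances of at least \<delta>, so
  \<open>kl_ge_square\<close> bounds all three divergences below by D.\<close>

lemma finite_time_bound: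
  assumes ucb: "kl_ucb_pp \<rho> K \<theta> T M F A Y" and KT: "K \<le> T"
    and a: "a \<in> {1..K}" and opt: "opt \<in> {1..K}"
    and \<delta>: "0 < \<delta>" "\<delta> \<le> (m (\<theta> opt) - m (\<theta> a)) / 3"
  shows "\<delta>\<^sup>2 / (2 * V) \<le> kl \<rho> (m (\<theta> a) + \<delta>) (m (\<theta> opt) - \<delta>)"
    and "(\<integral>w. real (pulls A a T w) \<partial>M) \<le>
     1 + (ln (real T) + ln (1 + (ln (real T))\<^sup>2)) / kl \<rho> (m (\<theta> a) + \<delta>) (m (\<theta> opt) - \<delta>)
       + (2 + 8 * exp 5) * real K / (\<delta>\<^sup>2 / (2 * V))"
proof -
  interpret exp_bandit \<rho> V K \<theta> T M F A Y by (rule exp_banditI[OF ucb])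
  obtain v where v: "m (\<theta> a) + \<delta> = m v" 
    using range_mean_between[of "\<theta> a" "m (\<theta> a) + \<delta>" "\<theta> opt"] \<delta> by auto
  obtain u where u: "m (\<theta> opt) - \<delta> = m u" 
    using range_mean_between[of "\<theta> a" "m (\<theta> opt) - \<delta>" "\<theta> opt"] \<delta> by auto
  have sq: "\<delta>\<^sup>2 / (2 * V) \<le> kl \<rho> (m s) (m t)" if "\<delta> \<le> \<bar>m s - m t\<bar>" for s t
  proof -
    have "\<delta>\<^sup>2 \<le> (m s - m t)\<^sup>2" using that \<delta>(1) by (intro abs_le_square_iff[THEN iffD1]) simp
    then have "\<delta>\<^sup>2 / (2 * V) \<le> (m s - m t)\<^sup>2 / (2 * V)" using V_pos by (intro divide_right_mono) auto
    also have "\<dots> \<le> kl \<rho> (m s) (m t)" by (rule kl_ge_square) (auto simp: mean_set_eq)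
    finally show ?thesis .
  qed
  have \<delta>3: "3 * \<delta> \<le> m (\<theta> opt) - m (\<theta> a)" using \<delta>(2) by simp
  have gap: "m (\<theta> a) + \<delta> \<le> m v" "m v + \<delta> \<le> m u" "m u + \<delta> \<le> m (\<theta> opt)"
    using \<delta>(1) \<delta>3 unfolding v[symmetric] u[symmetric] by linarith+
  then have "m (\<theta> a) < m v" "m v < m u" "m u < m (\<theta> opt)" using \<delta>(1) by linarith+
  then have order: "\<theta> a < v" "v < u" "u < \<theta> opt" using strict_mono_less[OF strict_mono_mean] by auto
  show "\<delta>\<^sup>2 / (2 * V) \<le> kl \<rho> (m (\<theta> a) + \<delta>) (m (\<theta> opt) - \<delta>)"
    unfolding v u using gap by (intro sq) simp
  show "(\<integral>w. real (pulls A a T w) \<partial>M) \<le>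
     1 + (ln (real T) + ln (1 + (ln (real T))\<^sup>2)) / kl \<rho> (m (\<theta> a) + \<delta>) (m (\<theta> opt) - \<delta>)
       + (2 + 8 * exp 5) * real K / (\<delta>\<^sup>2 / (2 * V))"
    unfolding v u
    using \<delta>(1) V_pos gap
    by (intro expected_pulls_le_kl[OF ucb KT a opt order] sq) auto
qed

text \<open>The three terms of the constant absorb, in order, the initial pull, the logarithm of 1 +
  (ln T)^2, which is at most 3 ln (ln T), and the terms of order 1 / D. From T = exp (exp 1) on, ln
  (ln T) is at least 1.\<close>

lemma asymptotic_form:
  assumes k: "\<delta>\<^sup>2 / (2 * V) \<le> k" and \<delta>: "0 < \<delta>" "\<delta> \<le> g" and T: "exp (exp 1) \<le> real T" and c: "0 \<le> c"
  shows "1 + (ln (real T) + ln (1 + (ln (real T))\<^sup>2)) / k + c / (\<delta>\<^sup>2 / (2 * V))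
    \<le> ln (real T) / k + (g\<^sup>2 + 6 * V + 2 * V * c) * (ln (ln (real T)) / \<delta>\<^sup>2)"
proof -
  define L where "L = ln (real T)"
  have L: "exp 1 \<le> L" unfolding L_def using ln_mono[OF T] by simp
  have L1: "1 \<le> L" using L exp_ge_add_one_self[of 1] by linarith
  have ll: "1 \<le> ln L" using ln_mono[OF L] by simp
  have d2: "0 < \<delta>\<^sup>2" using \<delta> by simp
  have "1 + L\<^sup>2 \<le> 2 * L\<^sup>2" using L1 by simp
  then have "ln (1 + L\<^sup>2) \<le> ln (2 * L\<^sup>2)" by (intro ln_mono) (auto simp: add_pos_nonneg)
  also have "\<dots> = ln 2 + 2 * ln L" using L1 by (simp add: ln_mult ln_realpow)
  also have "\<dots> \<le> 3 * ln L" using ll ln_le_minus_one[of 2] by simp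
  finally have l3: "ln (1 + L\<^sup>2) \<le> 3 * ln L" .
  have "ln (1 + L\<^sup>2) / k \<le> 3 * ln L / (\<delta>\<^sup>2 / (2 * V))"
    using l3 k d2 V_pos ll by (intro frac_le) auto
  then have 1: "ln (1 + L\<^sup>2) / k \<le> 6 * V * (ln L / \<delta>\<^sup>2)" by (simp add: mult_ac)
  have "\<delta>\<^sup>2 \<le> g\<^sup>2" using \<delta> by (intro power_mono) auto
  also have "\<dots> \<le> g\<^sup>2 * ln L" using mult_left_mono[OF ll, of "g\<^sup>2"] by simp
  finally have 2: "1 \<le> g\<^sup>2 * (ln L / \<delta>\<^sup>2)" using d2 by (simp add: field_simps)
  have "2 * V * c * 1 \<le> 2 * V * c * ln L" using ll c V_pos by (intro mult_left_mono) auto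
  then have 3: "c / (\<delta>\<^sup>2 / (2 * V)) \<le> 2 * V * c * (ln L / \<delta>\<^sup>2)" using d2 by (simp add: field_simps)
  from 1 2 3 show ?thesis unfolding L_def[symmetric] by (simp add: add_divide_distrib distrib_right)
qed

end

section \<open>Uniform bound on the pulls and asymptotic optimality\<close>

theorem theorem2:
  fixes \<rho> :: "real measure" and V \<mu>lo \<mu>hi :: real and K :: nat
    and \<theta> \<mu> :: "nat \<Rightarrow> real" and \<mu>star :: real
  assumes "canonical_exp_family \<rho>"
    and "0 < V" and "bounded_variance \<rho> V"
    and "\<mu>lo < \<mu>hi" and "{\<mu>lo..\<mu>hi} \<subseteq> mean_set \<rho>"
    and "2 \<le> K" and "bandit_model \<rho> \<mu>lo \<mu>hi K \<theta>"
  defines "\<mu> \<equiv> \<lambda>a. mean_fun \<rho> (\<theta> a)"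
    and "\<mu>star \<equiv> best_mean K \<mu>"
  shows
    "(\<forall>a\<in>{1..K}. \<mu> a < \<mu>star \<longrightarrow>
        (\<exists>C>0. \<exists>T0\<ge>3. \<forall>T\<ge>T0. \<forall>\<delta>.
           sqrt (22 * V * real K / real T) \<le> \<delta> \<and> \<delta> \<le> (\<mu>star - \<mu> a) / 3 \<longrightarrow>
           (\<forall>(M :: 'w measure) F A Y. kl_ucb_pp \<rho> K \<theta> T M F A Y \<longrightarrow>
              (\<integral>w. real (pulls A a T w) \<partial>M)
                \<le> ln (real T) / kl \<rho> (\<mu> a + \<delta>) (\<mu>star - \<delta>)
                   + C * (ln (ln (real T)) / \<delta>\<^sup>2)))) \<and>
     (\<exists>r. r \<in> o(\<lambda>T. ln (real T)) \<and>
        (\<forall>T (M :: 'w measure) F A Y. kl_ucb_pp \<rho> K \<theta> T M F A Y \<longrightarrow>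
           regret K \<mu> T M Y
             \<le> (\<Sum>a\<in>{a\<in>{1..K}. \<mu> a < \<mu>star}. (\<mu>star - \<mu> a) / kl \<rho> (\<mu> a) \<mu>star)
                 * ln (real T) + r T))"
proof -
  interpret bounded_exp_family \<rho> V by unfold_locales fact+
  have K1: "1 \<le> K" using \<open>2 \<le> K\<close> by simp
  have "\<mu>star \<in> \<mu> ` {1..K}"
    unfolding \<mu>star_def best_mean_def using K1 by (intro Max_in) auto
  then obtain opt where opt: "opt \<in> {1..K}" "\<mu>star = m (\<theta> opt)" by (auto simp: \<mu>_def)
  have le_star: "\<mu> a \<le> \<mu>star" if "a \<in> {1..K}" for a
    unfolding \<mu>star_def best_mean_def using that by (intro Max_ge) auto
  define C where "C a = (\<mu>star - \<mu> a)\<^sup>2 + 6 * V + 2 * V * ((2 + 8 * exp 5) * real K)" for a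
  \<comment> \<open>From K on the initialisation is complete, and from exp (exp 1) on the iterated
    logarithm is at least 1.\<close>
  define T0 where "T0 = max (max 3 K) (nat \<lceil>exp (exp 1) :: real\<rceil>)"
  have C: "0 < C a" for a
    unfolding C_def using V_pos by (intro add_nonneg_pos add_pos_nonneg) auto
  have T0: "K \<le> T" "exp (exp 1) \<le> real T" if "T0 \<le> T" for T
    using that unfolding T0_def by (auto simp: nat_le_iff ceiling_le_iff)
  have main: "(\<integral>w. real (pulls A a T w) \<partial>M)
      \<le> ln (real T) / kl \<rho> (\<mu> a + \<delta>) (\<mu>star - \<delta>) + C a * (ln (ln (real T)) / \<delta>\<^sup>2)"
    if "a \<in> {1..K}" "T0 \<le> T" "0 < \<delta>" "\<delta> \<le> (\<mu>star - \<mu> a) / 3" "kl_ucb_pp \<rho> K \<theta> T M F A Y"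
    for a T \<delta> and M :: "'w measure" and F A Y
  proof -
    have \<delta>: "\<delta> \<le> (m (\<theta> opt) - m (\<theta> a)) / 3" using that(4) opt(2) by (simp add: \<mu>_def)
    note fin = finite_time_bound[OF that(5) T0(1)[OF that(2)] that(1) opt(1) that(3) \<delta>]
    note fin(2)
    also note asymptotic_form[OF fin(1) that(3) _ T0(2)[OF that(2)], of "\<mu>star - \<mu> a"]
    finally show ?thesis using that(3,4) by (simp add: C_def opt(2) \<mu>_def)
  qed
  have pos: "0 < sqrt (22 * V * real K / real T)" if "T0 \<le> T" for T
    using V_pos K1 T0(1)[OF that] by simp
  define S where "S = {a \<in> {1..K}. \<mu> a < \<mu>star}"
  \<comment> \<open>Any width tending to 0 with ln (ln T) / d^2 = o(ln T) would do; this one makes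
    that term sqrt (ln T) * ln (ln T).\<close>
  define d where "d T = ln (real T) powr (- 1 / 4)" for T :: nat
  define h where "h a T = ln (real T) / kl \<rho> (\<mu> a + d T) (\<mu>star - d T) + C a * (ln (ln (real T)) / (d T)\<^sup>2)"
    for a T
  define good where "good T \<longleftrightarrow> T0 \<le> T \<and> 0 < d T \<and> (\<forall>a\<in>S. d T \<le> (\<mu>star - \<mu> a) / 3)" for T
  \<comment> \<open>The remainder depends on T alone, as it must serve all runs of the algorithm. At
    the horizons that are not good, which eventually cease, it is the trivial bound of T pulls per
    suboptimal arm.\<close>
  define r where "r T = (if good T then \<Sum>a\<in>S. (\<mu>star - \<mu> a) * (h a T - ln (real T) / kl \<rho> (\<mu> a) \<mu>star)
      else real T * (\<Sum>a\<in>S. \<mu>star - \<mu> a))" for T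
  have [simp]: "finite S" by (simp add: S_def)
  have d0: "d \<longlonglongrightarrow> 0" unfolding d_def by real_asymp
  have "eventually good sequentially"
  proof -
    have "eventually (\<lambda>T. 0 < d T) sequentially" unfolding d_def by real_asymp
    moreover have "eventually (\<lambda>T. d T \<le> (\<mu>star - \<mu> a) / 3) sequentially" if "a \<in> S" for a
      using order_tendstoD(2)[OF d0, of "(\<mu>star - \<mu> a) / 3"] that
      by (auto simp: S_def elim: eventually_mono)
    then have "eventually (\<lambda>T. \<forall>a\<in>S. d T \<le> (\<mu>star - \<mu> a) / 3) sequentially"
      by (simp add: eventually_ball_finite_distrib)
    moreover have "eventually (\<lambda>T. T0 \<le> T) sequentially" by (rule eventually_ge_at_top)
    ultimately show ?thesis unfolding good_def by eventually_elim blast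
  qed
  then have r_eq: "eventually (\<lambda>T. r T = (\<Sum>a\<in>S. (\<mu>star - \<mu> a) * (h a T - ln (real T) / kl \<rho> (\<mu> a) \<mu>star))) sequentially"
    by eventually_elim (simp add: r_def)
  have h_small: "(\<lambda>T. h a T - ln (real T) / kl \<rho> (\<mu> a) \<mu>star) \<in> o(\<lambda>T. ln (real T))" if a: "a \<in> S" for a
  proof (rule smalloI_tendsto)
    have klp: "0 < kl \<rho> (\<mu> a) \<mu>star"
      using a unfolding S_def opt(2) \<mu>_def by (intro kl_pos) simp
    have "(\<lambda>T. kl \<rho> (\<mu> a + d T) (\<mu>star - d T)) \<longlonglongrightarrow> kl \<rho> (\<mu> a) \<mu>star"
      unfolding opt(2) \<mu>_def by (intro kl_tendsto) (auto intro!: tendsto_eq_intros d0)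
    moreover have "(\<lambda>T. ln (ln (real T)) / (d T)\<^sup>2 / ln (real T)) \<longlonglongrightarrow> 0"
      unfolding d_def by real_asymp
    ultimately have "(\<lambda>T. 1 / kl \<rho> (\<mu> a + d T) (\<mu>star - d T) - 1 / kl \<rho> (\<mu> a) \<mu>star
        + C a * (ln (ln (real T)) / (d T)\<^sup>2 / ln (real T))) \<longlonglongrightarrow> 1 / kl \<rho> (\<mu> a) \<mu>star - 1 / kl \<rho> (\<mu> a) \<mu>star + C a * 0"
      using klp by (intro tendsto_intros) auto
    moreover have lp: "eventually (\<lambda>T. 0 < ln (real T)) sequentially" by real_asymp
    then have "eventually (\<lambda>T. 1 / kl \<rho> (\<mu> a + d T) (\<mu>star - d T) - 1 / kl \<rho> (\<mu> a) \<mu>star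
        + C a * (ln (ln (real T)) / (d T)\<^sup>2 / ln (real T)) =
        (h a T - ln (real T) / kl \<rho> (\<mu> a) \<mu>star) / ln (real T)) sequentially"
      by eventually_elim (simp add: h_def add_divide_distrib diff_divide_distrib)
    ultimately show "(\<lambda>T. (h a T - ln (real T) / kl \<rho> (\<mu> a) \<mu>star) / ln (real T)) \<longlonglongrightarrow> 0"
      by (simp add: tendsto_cong)
    show "eventually (\<lambda>T. ln (real T) \<noteq> 0) sequentially" using lp by eventually_elim simp
  qed
  have r_small: "r \<in> o(\<lambda>T. ln (real T))"
    unfolding landau_o.small.in_cong[OF r_eq]
    by (intro big_sum_in_smallo landau_o.small.cmult_in_iff' h_small) (use h_small in auto)
  have regret_bound: "regret K \<mu> T M Y \<le> (\<Sum>a\<in>S. (\<mu>star - \<mu> a) / kl \<rho> (\<mu> a) \<mu>star) * ln (real T) + r T"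
    if ucb: "kl_ucb_pp \<rho> K \<theta> T M F A Y" for T and M :: "'w measure" and F A Y
  proof -
    interpret exp_bandit \<rho> V K \<theta> T M F A Y by (rule exp_banditI[OF ucb])
    have np: "\<theta> a \<in> natural_params \<rho>" for a by (simp add: natural_params_UNIV)
    have "regret K \<mu> T M Y = (\<Sum>a=1..K. (\<mu>star - \<mu> a) * (\<integral>w. real (pulls A a T w) \<partial>M))"
      unfolding \<mu>star_def
      by (rule regret_eq) (simp_all add: integrable_exp_law[OF fam np] mean_exp_law[OF fam np] \<mu>_def)
    also have "\<dots> = (\<Sum>a\<in>S. (\<mu>star - \<mu> a) * (\<integral>w. real (pulls A a T w) \<partial>M))"
      unfolding S_def using le_star by (intro sum.mono_neutral_right) (auto simp: not_less order.antisym)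
    finally have reg: "regret K \<mu> T M Y = (\<Sum>a\<in>S. (\<mu>star - \<mu> a) * (\<integral>w. real (pulls A a T w) \<partial>M))" .
    have gap: "0 \<le> \<mu>star - \<mu> a" if "a \<in> S" for a using that by (simp add: S_def)
    show ?thesis
    proof (cases "good T")
      case True
      have "regret K \<mu> T M Y \<le> (\<Sum>a\<in>S. (\<mu>star - \<mu> a) * h a T)"
        unfolding reg h_def using True ucb
        by (intro sum_mono mult_left_mono main gap) (auto simp: good_def S_def)
      also have "\<dots> = (\<Sum>a\<in>S. (\<mu>star - \<mu> a) / kl \<rho> (\<mu> a) \<mu>star) * ln (real T) + r T"
        using True by (simp add: r_def sum_distrib_right right_diff_distrib sum_subtractf)
      finally show ?thesis .
    next
      case False
      have "regret K \<mu> T M Y \<le> (\<Sum>a\<in>S. (\<mu>star - \<mu> a) * real T)"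
        unfolding reg by (intro sum_mono mult_left_mono expected_pulls_le gap)
      also have "\<dots> = r T" using False by (simp add: r_def sum_distrib_left mult.commute)
      finally have "regret K \<mu> T M Y \<le> r T" .
      moreover have "0 \<le> (\<Sum>a\<in>S. (\<mu>star - \<mu> a) / kl \<rho> (\<mu> a) \<mu>star) * ln (real T)"
      proof (intro mult_nonneg_nonneg sum_nonneg divide_nonneg_nonneg gap)
        show "0 \<le> kl \<rho> (\<mu> a) \<mu>star" for a unfolding opt(2) \<mu>_def by (rule kl_nonneg)
        \<comment> \<open>The empty game is covered by the convention ln 0 = 0.\<close>
        show "0 \<le> ln (real T)" by (cases "T = 0") auto
      qed
      ultimately show ?thesis by linarith
    qed
  qed
  have "\<exists>C>0. \<exists>T0\<ge>3. \<forall>T\<ge>T0. \<forall>\<delta>.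
      sqrt (22 * V * real K / real T) \<le> \<delta> \<and> \<delta> \<le> (\<mu>star - \<mu> a) / 3 \<longrightarrow>
      (\<forall>(M :: 'w measure) F A Y. kl_ucb_pp \<rho> K \<theta> T M F A Y \<longrightarrow>
         (\<integral>w. real (pulls A a T w) \<partial>M)
           \<le> ln (real T) / kl \<rho> (\<mu> a + \<delta>) (\<mu>star - \<delta>) + C * (ln (ln (real T)) / \<delta>\<^sup>2))"
    if a: "a \<in> {1..K}" for a
  proof (intro exI[of _ "C a"] exI[of _ T0] conjI allI impI C)
    show "3 \<le> T0" by (simp add: T0_def)
    fix T \<delta> and M :: "'w measure" and F A Y
    assume "T0 \<le> T" "sqrt (22 * V * real K / real T) \<le> \<delta> \<and> \<delta> \<le> (\<mu>star - \<mu> a) / 3"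
      "kl_ucb_pp \<rho> K \<theta> T M F A Y"
    then show "(\<integral>w. real (pulls A a T w) \<partial>M)
           \<le> ln (real T) / kl \<rho> (\<mu> a + \<delta>) (\<mu>star - \<delta>) + C a * (ln (ln (real T)) / \<delta>\<^sup>2)"
      using pos[of T] by (intro main[OF a]) linarith+
  qed
  with r_small regret_bound show ?thesis unfolding S_def[symmetric] by blast
qed

end
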